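(* Every ${\bf i}\in\widehat I_M$ can be written in the form $${\bf i}=\Big(\sum_{i=1}^{n}P_i(x)\,\partial_x^{\,i}+P_0(x)\Big)+f(x,y)\,\theta(x-y),\qquad P_0,\dots,P_n\in\boldsymbol{B_1},\ f\in\boldsymbol{B_2},$$ and this expression is unique, in the sense that all the $P_i$ and $f$ are uniquely determined by ${\bf i}$ (up to adding or omitting terms $P_i\partial_x^i$ with $P_i$ identically zero).
   Context: Fix real numbers $a<b$. $\boldsymbol{B_1}$ is the algebra of smooth functions $P:[a,b]\to\mathbb C$. $\Delta=\{(x,y): a\le y\le x\le b\}$, and $\boldsymbol{B_2}$ is the algebra of smooth functions $f:\Delta\to\mathbb C$ (all partial derivatives of all orders exist and are continuous on $\Delta$). $M[a,b]$ is the vector space of all smooth functions $\phi:[a,b]\to\mathbb C$ with $\phi(a)=0$ and $\frac{d^k\phi}{dx^k}(a)=0$ for all $k\ge 1$. $\widehat I_M$ is the subalgebra of $\mathrm{End}_{\mathbb C}(M[a,b])$ generated by the multiplication operators $P(x):\phi\mapsto P\phi$ ($P\in\boldsymbol{B_1}$), the derivative $\partial_x:\phi\mapsto\phi'$, and the Volterra operators $f(x,y)\theta(x-y):\phi\mapsto\int_a^x f(x,z)\phi(z)\,dz$ ($f\in\boldsymbol{B_2}$). *)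

theory Defs
  imports "HOL-Analysis.Analysis"
begin

text \<open>Functions on \<open>[a,b]\<close>, functions on the triangle and operators on \<open>M[a,b]\<close> are represented as
  members of \<^const>\<open>extensional\<close> on the respective domain, so that HOL equality is equality on
  that domain.\<close>

subsection \<open>Smooth functions\<close>

text \<open>The derivative is one-sided at \<open>a\<close> and \<open>b\<close>.\<close>

definition deriv_interval :: "real \<Rightarrow> real \<Rightarrow> (real \<Rightarrow> complex) \<Rightarrow> real \<Rightarrow> complex" where
  "deriv_interval a b \<phi> = (\<lambda>x\<in>{a..b}. vector_derivative \<phi> (at x within {a..b}))"

definition smooth_interval :: "real \<Rightarrow> real \<Rightarrow> (real \<Rightarrow> complex) set" where
  "smooth_interval a b =
     {P \<in> extensional {a..b}. \<forall>k. (deriv_interval a b ^^ k) P differentiable_on {a..b}}"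

definition triangle :: "real \<Rightarrow> real \<Rightarrow> (real \<times> real) set" where
  "triangle a b = {(x, y). a \<le> y \<and> y \<le> x \<and> x \<le> b}"

text \<open>Coinductively: \<open>f\<close> is continuous on the triangle and has partial derivatives there which are
  again of this kind. For \<open>(x, y)\<close> in the triangle, \<open>{y..b}\<close> and \<open>{a..x}\<close> are the horizontal and
  vertical sections through \<open>(x, y)\<close>, so partial derivatives are one-sided at the edges. The
  horizontal section through \<open>(b, b)\<close> and the vertical one through \<open>(a, a)\<close> are single points,
  where the derivative condition is vacuous; there \<open>f\<^sub>x\<close>, respectively \<open>f\<^sub>y\<close>, is determined by
  continuity.\<close>

coinductive smooth_on_triangle :: "real \<Rightarrow> real \<Rightarrow> (real \<times> real \<Rightarrow> complex) \<Rightarrow> bool"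
  for a b :: real where
  "\<lbrakk>continuous_on (triangle a b) f;
    \<forall>(x, y)\<in>triangle a b.
      ((\<lambda>s. f (s, y)) has_vector_derivative f\<^sub>x (x, y)) (at x within {y..b});
    \<forall>(x, y)\<in>triangle a b.
      ((\<lambda>t. f (x, t)) has_vector_derivative f\<^sub>y (x, y)) (at y within {a..x});
    smooth_on_triangle a b f\<^sub>x;
    smooth_on_triangle a b f\<^sub>y\<rbrakk>
   \<Longrightarrow> smooth_on_triangle a b f"

definition smooth_triangle :: "real \<Rightarrow> real \<Rightarrow> (real \<times> real \<Rightarrow> complex) set" where
  "smooth_triangle a b = {f \<in> extensional (triangle a b). smooth_on_triangle a b f}"

text \<open>The space \<open>M[a,b]\<close>; the case \<open>k = 0\<close> is the condition \<open>\<phi> a = 0\<close>.\<close>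

definition flat_functions :: "real \<Rightarrow> real \<Rightarrow> (real \<Rightarrow> complex) set" where
  "flat_functions a b = {\<phi> \<in> smooth_interval a b. \<forall>k. (deriv_interval a b ^^ k) \<phi> a = 0}"

subsection \<open>Operators on \<open>M[a,b]\<close>\<close>

type_synonym operator = "(real \<Rightarrow> complex) \<Rightarrow> real \<Rightarrow> complex"

definition op_mult :: "real \<Rightarrow> real \<Rightarrow> (real \<Rightarrow> complex) \<Rightarrow> operator" where
  "op_mult a b P = (\<lambda>\<phi>\<in>flat_functions a b. \<lambda>x\<in>{a..b}. P x * \<phi> x)"

definition op_deriv :: "real \<Rightarrow> real \<Rightarrow> operator" where
  "op_deriv a b = (\<lambda>\<phi>\<in>flat_functions a b. deriv_interval a b \<phi>)"

definition op_volterra :: "real \<Rightarrow> real \<Rightarrow> (real \<times> real \<Rightarrow> complex) \<Rightarrow> operator" where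
  "op_volterra a b f = (\<lambda>\<phi>\<in>flat_functions a b. \<lambda>x\<in>{a..b}. integral {a..x} (\<lambda>z. f (x, z) * \<phi> z))"

definition op_add :: "real \<Rightarrow> real \<Rightarrow> operator \<Rightarrow> operator \<Rightarrow> operator" where
  "op_add a b S T = (\<lambda>\<phi>\<in>flat_functions a b. \<lambda>x\<in>{a..b}. S \<phi> x + T \<phi> x)"

definition op_scale :: "real \<Rightarrow> real \<Rightarrow> complex \<Rightarrow> operator \<Rightarrow> operator" where
  "op_scale a b c T = (\<lambda>\<phi>\<in>flat_functions a b. \<lambda>x\<in>{a..b}. c * T \<phi> x)"

text \<open>The algebra \<open>I\<^sub>M\<close> generated by multiplications, the derivative and Volterra operators. The
  generators are linear endomorphisms of \<open>flat_functions a b\<close>, so this is a subalgebra of the endomorphism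
  algebra; it is unital since multiplication by the constant 1 is the identity.\<close>

inductive_set I_M :: "real \<Rightarrow> real \<Rightarrow> operator set" for a b :: real where
  mult: "P \<in> smooth_interval a b \<Longrightarrow> op_mult a b P \<in> I_M a b"
| deriv: "op_deriv a b \<in> I_M a b"
| volterra: "f \<in> smooth_triangle a b \<Longrightarrow> op_volterra a b f \<in> I_M a b"
| add: "S \<in> I_M a b \<Longrightarrow> T \<in> I_M a b \<Longrightarrow> op_add a b S T \<in> I_M a b"
| scale: "T \<in> I_M a b \<Longrightarrow> op_scale a b c T \<in> I_M a b"
| comp: "S \<in> I_M a b \<Longrightarrow> T \<in> I_M a b \<Longrightarrow> compose (flat_functions a b) S T \<in> I_M a b"

definition normal_form ::
  "real \<Rightarrow> real \<Rightarrow> nat \<Rightarrow> (nat \<Rightarrow> real \<Rightarrow> complex) \<Rightarrow> (real \<times> real \<Rightarrow> complex) \<Rightarrow> operator" where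
  "normal_form a b n P f = (\<lambda>\<phi>\<in>flat_functions a b. \<lambda>x\<in>{a..b}.
     ((\<Sum>i=1..n. op_mult a b (P i) ((op_deriv a b ^^ i) \<phi>) x) + op_mult a b (P 0) \<phi> x)
     + op_volterra a b f \<phi> x)"

end

theory Submission
  imports Defs
begin

text \<open>
  Existence. The operators of the form \<open>\<Sum> P\<^sub>i \<partial>\<^sup>i\<close> plus a Volterra operator form a set that contains
  the identity, so it is enough that composing on the left with each of the generators does not lead out of
  it. On single summands this comes down to these rules, for \<open>f\<close> and \<open>g\<close> smooth on the triangle and \<open>V\<^sub>f\<close> the
  Volterra operator of \<open>f\<close>:

  \<^item> \<open>\<partial> P = P \<partial> + P'\<close> and \<open>P V\<^sub>f = V\<^sub>h\<close> with \<open>h (x, y) = P x * f (x, y)\<close>;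
  \<^item> \<open>\<partial> V\<^sub>f = f (x, x) + V\<^sub>h\<close> with \<open>h\<close> the derivative of \<open>f\<close> in the first variable (Leibniz rule);
  \<^item> \<open>V\<^sub>f \<partial> = f (x, x) - V\<^sub>h\<close> with \<open>h\<close> the derivative of \<open>f\<close> in the second variable (integration by
    parts, where flatness at \<open>a\<close> removes the lower boundary term), and \<open>V\<^sub>f P = V\<^sub>h\<close> with
    \<open>h (x, y) = f (x, y) * P y\<close>;
  \<^item> \<open>V\<^sub>f V\<^sub>g = V\<^sub>h\<close> with \<open>h (x, y)\<close> the integral of \<open>f (x, z) * g (z, y)\<close> over \<open>y \<le> z \<le> x\<close>
    (interchange of integrations).

  The analytic content is that the new kernels and coefficients, in particular diagonals \<open>f (x, x)\<close> and convolutions,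
  are again smooth, and that all operators preserve flatness at \<open>a\<close>. Both follow from one principle:
  a class of functions closed under differentiation consists of smooth functions, and of
  flat ones if its members vanish at \<open>a\<close>. In each case one writes down what can arise by differentiating and
  checks closure with the Leibniz rule \<open>triangle_integral_has_vector_derivative\<close>.

  Uniqueness. The difference of two normal forms of the same operator annihilates all flat functions. At a point
  \<open>x\<close>, test functions supported to the left of \<open>x\<close> see only the kernel, which therefore vanishes
  (\<open>integral_against_bumps_zero\<close>). The remaining differential operator annihilates all jets at \<open>x\<close>
  of flat functions, and commuting it with multiplication by \<open>t - x\<close> lowers its order
  (\<open>jet_coefficients_zero\<close>), so its coefficients vanish as well.
\<close>

section \<open>Integrals over sections of the triangle\<close>

lemma triangle_iff: "(x, y) \<in> triangle a b \<longleftrightarrow> a \<le> y \<and> y \<le> x \<and> x \<le> b"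
  by (simp add: triangle_def)

lemma continuous_on_triangle_section:
  assumes "continuous_on (triangle a b) h" "x \<in> {a..b}"
  shows "continuous_on {a..x} (\<lambda>z. h (x, z))"
  by (rule continuous_on_compose2[OF assms(1)])
    (use assms(2) in \<open>auto intro!: continuous_intros simp: triangle_def\<close>)

lemma continuous_on_triangle_diagonal:
  assumes "continuous_on (triangle a b) h"
  shows "continuous_on {a..b} (\<lambda>z. h (z, z))"
  by (rule continuous_on_compose2[OF assms(1)])
    (auto intro!: continuous_intros simp: triangle_def)

text \<open>The Leibniz rule for a variable upper limit, with data given on the triangle only. Extending \<open>h\<close>
above the diagonal by its tangent in the first variable gives a function \<open>H\<close> on the square
that is \<open>C\<^sup>1\<close> in that variable, so that the integral of \<open>H\<close> over the fixed interval \<open>[a,b]\<close> can be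
differentiated under the integral sign. The surplus over \<open>[s,b]\<close> is affine in \<open>s\<close> under the integral,
and the fundamental theorem of calculus takes care of it.\<close>

lemma triangle_integral_has_vector_derivative:
  fixes h hx :: "real \<times> real \<Rightarrow> complex"
  assumes h: "continuous_on (triangle a b) h" and hx: "continuous_on (triangle a b) hx"
    and d: "\<And>x y. (x, y) \<in> triangle a b \<Longrightarrow>
      ((\<lambda>s. h (s, y)) has_vector_derivative hx (x, y)) (at x within {y..b})"
    and x: "x \<in> {a..b}"
  shows "((\<lambda>s. integral {a..s} (\<lambda>z. h (s, z))) has_vector_derivative
      h (x, x) + integral {a..x} (\<lambda>z. hx (x, z))) (at x within {a..b})"
proof -
  \<comment> \<open>On the diagonal both branches of \<open>H\<close> and both derivatives agree, even at the corner \<open>(b, b)\<close>,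
    where the horizontal section of the triangle is a single point.\<close>
  define tangent where "tangent s z = h (z, z) + (s - z) *\<^sub>R hx (z, z)" for s z
  define H where "H s z = (if s \<in> {a..z} then tangent s z else h (s, z))" for s z
  define H' where "H' s z = hx (max s z, z)" for s z
  note diag = continuous_on_triangle_diagonal[OF h] continuous_on_triangle_diagonal[OF hx]
  have dH: "((\<lambda>s. H s z) has_vector_derivative H' s z) (at s within {a..b})"
    if s: "s \<in> {a..b}" and z: "z \<in> {a..b}" for s z
  proof -
    have clo: "closure {a..z} \<inter> closure {z..b} = {z}" using z by auto
    have "((\<lambda>s. if s \<in> {a..z} then tangent s z else h (s, z)) has_vector_derivative
        (if s \<in> {a..z} then hx (z, z) else hx (s, z))) (at s within {a..b})"
    proof (rule has_vector_derivative_If_within_closures[where T = "{z..b}"])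
      show "((\<lambda>s. tangent s z) has_vector_derivative hx (z, z))
          (at s within {a..z} \<union> (closure {a..z} \<inter> closure {z..b}))"
        unfolding tangent_def by (auto intro!: derivative_eq_intros)
      show "((\<lambda>s. h (s, z)) has_vector_derivative hx (s, z))
          (at s within {z..b} \<union> (closure {a..z} \<inter> closure {z..b}))"
        if "s \<in> {z..b} \<union> (closure {a..z} \<inter> closure {z..b})"
      proof -
        have "{z..b} \<union> {z} = {z..b}" using z by auto
        then show ?thesis using that z d[of s z] unfolding clo by (auto simp: triangle_iff)
      qed
    qed (use s z clo in \<open>auto simp: tangent_def\<close>)
    moreover have "(if s \<in> {a..z} then hx (z, z) else hx (s, z)) = H' s z"
      using s by (auto simp: H'_def max_def)
    ultimately show ?thesis by (simp add: H_def)
  qed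
  have Heq: "H s z = h (max s z, z) + (min s z - z) *\<^sub>R hx (z, z)" if "s \<in> {a..b}" for s z
    using that by (auto simp: H_def tangent_def max_def min_def)
  have Hcont: "continuous_on {a..b} (H s)" if s: "s \<in> {a..b}" for s
  proof -
    have "continuous_on {a..b} (\<lambda>z. h (max s z, z) + (min s z - z) *\<^sub>R hx (z, z))"
      by (intro continuous_intros diag continuous_on_compose2[OF h])
        (use s in \<open>auto simp: triangle_def\<close>)
    then show ?thesis using Heq[OF s] by (simp cong: continuous_on_cong)
  qed
  have "((\<lambda>s. integral (cbox a b) (H s)) has_vector_derivative integral (cbox a b) (H' x))
      (at x within {a..b})"
  proof (rule leibniz_rule_vector_derivative)
    show "continuous_on ({a..b} \<times> cbox a b) (\<lambda>(x, t). H' x t)"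
      unfolding H'_def case_prod_unfold
      by (intro continuous_on_compose2[OF hx] continuous_intros) (auto simp: triangle_def)
  qed (use dH Hcont x in \<open>auto intro: integrable_continuous_real\<close>)
  then have d1: "((\<lambda>s. integral {a..b} (H s)) has_vector_derivative integral {a..b} (H' x))
      (at x within {a..b})" by simp
  define u where "u z = h (z, z) - z *\<^sub>R hx (z, z)" for z
  have uc: "continuous_on {a..b} u"
    unfolding u_def by (intro continuous_intros diag)
  have split: "integral {a..s} (\<lambda>z. h (s, z)) =
      integral {a..b} (H s) - (integral {s..b} u + s *\<^sub>R integral {s..b} (\<lambda>z. hx (z, z)))"
    if s: "s \<in> {a..b}" for s
  proof -
    have "integral {a..b} (H s) = integral {a..s} (H s) + integral {s..b} (H s)"
      using s Hcont[OF s] by (simp add: Henstock_Kurzweil_Integration.integral_combine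
          integrable_continuous_real)
    also have "integral {a..s} (H s) = integral {a..s} (\<lambda>z. h (s, z))"
      by (rule integral_cong) (use s in \<open>auto simp: Heq max_def min_def\<close>)
    also have "integral {s..b} (H s) = integral {s..b} (\<lambda>z. u z + s *\<^sub>R hx (z, z))"
      by (rule integral_cong) (use s in \<open>auto simp: Heq max_def min_def u_def algebra_simps\<close>)
    also have "\<dots> = integral {s..b} u + s *\<^sub>R integral {s..b} (\<lambda>z. hx (z, z))"
      using s by (subst integral_add) (auto intro!: integrable_continuous_real continuous_intros
          continuous_on_subset[OF uc] continuous_on_subset[OF diag(2)])
    finally show ?thesis by simp
  qed
  have "((\<lambda>s. integral {a..b} (H s) - (integral {s..b} u + s *\<^sub>R integral {s..b} (\<lambda>z. hx (z, z))))
      has_vector_derivative integral {a..b} (H' x) -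
        (- u x + (x *\<^sub>R (- hx (x, x)) + 1 *\<^sub>R integral {x..b} (\<lambda>z. hx (z, z)))))
      (at x within {a..b})"
    by (intro has_vector_derivative_diff has_vector_derivative_add has_vector_derivative_scaleR
        d1 integral_has_vector_derivative'[OF uc x] integral_has_vector_derivative'[OF diag(2) x])
      (auto intro!: derivative_eq_intros)
  moreover have "integral {a..b} (H' x) = integral {a..x} (\<lambda>z. hx (x, z)) + integral {x..b} (\<lambda>z. hx (z, z))"
  proof -
    have "continuous_on {a..b} (H' x)" unfolding H'_def
      by (intro continuous_on_compose2[OF hx] continuous_intros) (use x in \<open>auto simp: triangle_def\<close>)
    then have "integral {a..b} (H' x) = integral {a..x} (H' x) + integral {x..b} (H' x)"
      using x by (simp add: Henstock_Kurzweil_Integration.integral_combine integrable_continuous_real)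
    also have "integral {a..x} (H' x) = integral {a..x} (\<lambda>z. hx (x, z))"
      by (rule integral_cong) (auto simp: H'_def max_def)
    also have "integral {x..b} (H' x) = integral {x..b} (\<lambda>z. hx (z, z))"
      by (rule integral_cong) (auto simp: H'_def max_def)
    finally show ?thesis .
  qed
  ultimately have "((\<lambda>s. integral {a..b} (H s) - (integral {s..b} u + s *\<^sub>R integral {s..b} (\<lambda>z. hx (z, z))))
      has_vector_derivative h (x, x) + integral {a..x} (\<lambda>z. hx (x, z))) (at x within {a..b})"
    by (simp add: u_def algebra_simps)
  then show ?thesis
    using split by (rule has_vector_derivative_transform[OF x, rotated])
qed

text \<open>The reflection \<open>(z, y) \<mapsto> (- y, - z)\<close> maps the triangle over \<open>[a,b]\<close> to the one over \<open>[- b,- a]\<close>, exchanges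
its horizontal and vertical sections, and turns a variable lower limit into a variable upper limit.\<close>

lemma triangle_integral_has_vector_derivative_lower:
  fixes h hy :: "real \<Rightarrow> real \<Rightarrow> complex"
  assumes h: "continuous_on (triangle a b) (\<lambda>(z, y). h z y)"
    and hy: "continuous_on (triangle a b) (\<lambda>(z, y). hy z y)"
    and d: "\<And>z y. (z, y) \<in> triangle a b \<Longrightarrow>
      ((\<lambda>t. h z t) has_vector_derivative hy z y) (at y within {a..z})"
    and y: "y \<in> {a..b}"
  shows "((\<lambda>t. integral {t..b} (\<lambda>z. h z t)) has_vector_derivative
      integral {y..b} (\<lambda>z. hy z y) - h y y) (at y within {a..b})"
proof -
  define k where "k = (\<lambda>(s, w). h (- w) (- s))"
  define k' where "k' = (\<lambda>(s, w). - hy (- w) (- s))"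
  have "continuous_on (triangle (- b) (- a)) (\<lambda>p. (\<lambda>(z, y). h z y) (- snd p, - fst p))"
    by (rule continuous_on_compose2[OF h])
      (auto simp: triangle_def intro!: continuous_intros)
  then have kc: "continuous_on (triangle (- b) (- a)) k"
    by (auto simp: k_def case_prod_unfold intro!: continuous_intros)
  have "continuous_on (triangle (- b) (- a)) (\<lambda>p. (\<lambda>(z, y). hy z y) (- snd p, - fst p))"
    by (rule continuous_on_compose2[OF hy])
      (auto simp: triangle_def intro!: continuous_intros)
  then have kc': "continuous_on (triangle (- b) (- a)) k'"
    by (auto simp: k'_def case_prod_unfold intro!: continuous_intros)
  have img: "uminus ` {p..q} = {- q..- p}" for p q :: real
    by simp
  have dk: "((\<lambda>s. k (s, w)) has_vector_derivative k' (s, w)) (at s within {w..- a})"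
    if "(s, w) \<in> triangle (- b) (- a)" for s w
  proof -
    have "(((\<lambda>t. h (- w) t) \<circ> uminus) has_vector_derivative (- 1) *\<^sub>R hy (- w) (- s))
        (at s within {w..- a})"
      by (rule vector_diff_chain_within)
        (use that d[of "- w" "- s"] in \<open>auto simp: img triangle_def intro!: derivative_eq_intros\<close>)
    then show ?thesis by (simp add: k_def k'_def o_def)
  qed
  have "((\<lambda>s. integral {- b..s} (\<lambda>z. k (s, z))) has_vector_derivative
      k (- y, - y) + integral {- b..- y} (\<lambda>z. k' (- y, z))) (at (- y) within {- b..- a})"
    by (rule triangle_integral_has_vector_derivative[OF kc kc' dk]) (use y in auto)
  then have "((\<lambda>s. integral {- b..s} (\<lambda>z. k (s, z))) \<circ> uminus has_vector_derivative
      (- 1) *\<^sub>R (k (- y, - y) + integral {- b..- y} (\<lambda>z. k' (- y, z)))) (at y within {a..b})"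
    by (intro vector_diff_chain_within) (auto simp: img intro!: derivative_eq_intros)
  moreover have "integral {- b..- t} (\<lambda>z. k (- t, z)) = integral {t..b} (\<lambda>z. h z t)" for t
    using Henstock_Kurzweil_Integration.integral_reflect_real[of b t "\<lambda>z. h z t"]
    by (simp add: k_def)
  moreover have "integral {- b..- t} (\<lambda>z. k' (- t, z)) = - integral {t..b} (\<lambda>z. hy z t)" for t
    using Henstock_Kurzweil_Integration.integral_reflect_real[of b t "\<lambda>z. hy z t"]
    by (simp add: k'_def)
  ultimately show ?thesis by (simp add: o_def k_def)
qed

text \<open>Substituting \<open>z = y + s (x - y)\<close> moves the variable limits into the integrand, over the fixed interval
\<open>[0,1]\<close>.\<close>

lemma continuous_on_triangle_integral:
  fixes F :: "real \<times> real \<Rightarrow> real \<Rightarrow> complex"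
  assumes F: "continuous_on {((x, y), z). a \<le> y \<and> y \<le> z \<and> z \<le> x \<and> x \<le> b} (\<lambda>(p, z). F p z)"
  shows "continuous_on (triangle a b) (\<lambda>(x, y). integral {y..x} (F (x, y)))"
proof -
  have rescale: "integral {y..x} (F (x, y)) =
      (x - y) *\<^sub>R integral {0..1} (\<lambda>s. F (x, y) (y + s * (x - y)))"
    if xy: "(x, y) \<in> triangle a b" for x y
  proof -
    have le: "y \<le> x" using xy by (simp add: triangle_iff)
    have "continuous_on {y..x} (\<lambda>z. (\<lambda>(p, z). F p z) ((x, y), z))"
      by (rule continuous_on_compose2[OF F])
        (use xy in \<open>auto simp: triangle_iff intro!: continuous_intros\<close>)
    then have Fc: "continuous_on {y..x} (F (x, y))" by simp
    have "((\<lambda>s. (x - y) *\<^sub>R F (x, y) (y + s * (x - y))) has_integral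
        integral {y + 0 * (x - y)..y + 1 * (x - y)} (F (x, y))) {0..1}"
    proof (rule has_integral_substitution[where c = y and d = x])
      have "0 \<le> s * (x - y) \<and> s * (x - y) \<le> x - y" if "s \<in> {0..1}" for s
        using le that by (auto intro: mult_left_le_one_le)
      then show "(\<lambda>s. y + s * (x - y)) ` {0..1} \<subseteq> {y..x}"
        by force
    qed (use le Fc in \<open>auto intro!: derivative_eq_intros\<close>)
    from integral_unique[OF this] show ?thesis by simp
  qed
  have "continuous_on (triangle a b)
      (\<lambda>p. integral (cbox 0 1) (\<lambda>s. F p (snd p + s * (fst p - snd p))))"
  proof (rule integral_continuous_on_param)
    have "0 \<le> s * (x - y) \<and> s * (x - y) \<le> x - y" if "s \<in> {0..1}" "y \<le> x" for s x y :: real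
      using that by (auto intro: mult_left_le_one_le)
    then have "(\<lambda>q. (fst q, snd (fst q) + snd q * (fst (fst q) - snd (fst q)))) `
        (triangle a b \<times> cbox 0 1) \<subseteq> {((x, y), z). a \<le> y \<and> y \<le> z \<and> z \<le> x \<and> x \<le> b}"
      by (force simp: triangle_def)
    then have "continuous_on (triangle a b \<times> cbox 0 1) (\<lambda>q. (\<lambda>(p, z). F p z)
        (fst q, snd (fst q) + snd q * (fst (fst q) - snd (fst q))))"
      by (intro continuous_on_compose2[OF F] continuous_intros)
    then show "continuous_on (triangle a b \<times> cbox 0 1)
        (\<lambda>(p, s). F p (snd p + s * (fst p - snd p)))"
      by (simp add: case_prod_unfold)
  qed
  then have "continuous_on (triangle a b)
      (\<lambda>p. (fst p - snd p) *\<^sub>R integral {0..1} (\<lambda>s. F p (snd p + s * (fst p - snd p))))"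
    by (auto intro!: continuous_intros)
  then show ?thesis
    by (rule continuous_on_cong[THEN iffD1, rotated -1]) (auto simp: rescale)
qed

text \<open>Dirichlet's interchange of the order of integration. As functions of the upper limit, both sides
vanish at \<open>a\<close> and have the same derivative: in the inner integral on the right, the boundary term of
the Leibniz rule is an integral over a single point.\<close>

lemma triangle_integral_swap:
  fixes u :: "real \<times> real \<Rightarrow> complex"
  assumes u: "continuous_on (triangle a b) u" and x: "x \<in> {a..b}"
  shows "integral {a..x} (\<lambda>z. integral {a..z} (\<lambda>y. u (z, y))) =
         integral {a..x} (\<lambda>y. integral {y..x} (\<lambda>z. u (z, y)))"
proof -
  define K where "K = (\<lambda>(t, y). integral {y..t} (\<lambda>z. u (z, y)))"
  define c where "c z = integral {a..z} (\<lambda>y. u (z, y))" for z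
  have Kc: "continuous_on (triangle a b) K"
    unfolding K_def
    by (rule continuous_on_triangle_integral[of a b "\<lambda>p z. u (z, snd p)", simplified])
      (auto simp: case_prod_unfold triangle_def intro!: continuous_on_compose2[OF u] continuous_intros)
  have "continuous_on (triangle a b) (\<lambda>(x, y). integral {y..x} (\<lambda>w. u (x, w)))"
    by (rule continuous_on_triangle_integral[of a b "\<lambda>p w. u (fst p, w)", simplified])
      (auto simp: case_prod_unfold triangle_def intro!: continuous_on_compose2[OF u] continuous_intros)
  then have "continuous_on {a..b} (\<lambda>z. (\<lambda>(x, y). integral {y..x} (\<lambda>w. u (x, w))) (z, a))"
    by (rule continuous_on_compose2) (auto simp: triangle_def intro!: continuous_intros)
  then have cc: "continuous_on {a..b} c" by (simp add: c_def)
  define F where "F t = integral {a..t} c" for t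
  define G where "G t = integral {a..t} (\<lambda>y. K (t, y))" for t
  have dG: "(G has_vector_derivative c t) (at t within {a..b})" if t: "t \<in> {a..b}" for t
  proof -
    have "(G has_vector_derivative K (t, t) + integral {a..t} (\<lambda>y. u (t, y))) (at t within {a..b})"
      unfolding G_def
    proof (rule triangle_integral_has_vector_derivative[OF Kc u _ t])
      fix x y assume xy: "(x, y) \<in> triangle a b"
      have "continuous_on {y..b} (\<lambda>z. u (z, y))"
        using xy by (auto simp: triangle_def intro!: continuous_on_compose2[OF u] continuous_intros)
      then show "((\<lambda>s. K (s, y)) has_vector_derivative u (x, y)) (at x within {y..b})"
        using xy integral_has_vector_derivative[of y b "\<lambda>z. u (z, y)" x]
        by (simp add: K_def triangle_iff)
    qed
    then show ?thesis by (simp add: K_def c_def)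
  qed
  have dF: "(F has_vector_derivative c t) (at t within {a..b})" if t: "t \<in> {a..b}" for t
    unfolding F_def by (rule integral_has_vector_derivative[OF cc t])
  have "((\<lambda>t. F t - G t) has_derivative (\<lambda>h. 0)) (at t within {a..b})" if t: "t \<in> {a..b}" for t
    using has_vector_derivative_diff[OF dF[OF t] dG[OF t]] by (simp add: has_vector_derivative_def)
  then obtain k where k: "\<And>t. t \<in> {a..b} \<Longrightarrow> F t - G t = k"
    using has_derivative_zero_constant[of "{a..b}" "\<lambda>t. F t - G t"] by (auto simp: convex_real_interval)
  have "k = 0" using k[of a] x by (simp add: F_def G_def)
  then show ?thesis using k[OF x] by (simp add: F_def G_def K_def c_def[abs_def])
qed


section \<open>Smooth functions on the triangle\<close>

text \<open>One unfolding step of \<^const>\<open>smooth_on_triangle\<close>. The partial derivatives are arguments because at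
the corners \<open>(b, b)\<close> and \<open>(a, a)\<close> they are not determined by the derivative conditions.\<close>

definition has_triangle_partials ::
  "real \<Rightarrow> real \<Rightarrow> (real \<times> real \<Rightarrow> complex) \<Rightarrow> (real \<times> real \<Rightarrow> complex) \<Rightarrow> (real \<times> real \<Rightarrow> complex) \<Rightarrow> bool" where
  "has_triangle_partials a b f fx fy \<longleftrightarrow> continuous_on (triangle a b) f \<and>
    (\<forall>x y. (x, y) \<in> triangle a b \<longrightarrow>
      ((\<lambda>s. f (s, y)) has_vector_derivative fx (x, y)) (at x within {y..b})) \<and>
    (\<forall>x y. (x, y) \<in> triangle a b \<longrightarrow>
      ((\<lambda>t. f (x, t)) has_vector_derivative fy (x, y)) (at y within {a..x}))"

lemma has_triangle_partialsD:
  assumes "has_triangle_partials a b f fx fy"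
  shows "continuous_on (triangle a b) f"
    and "(x, y) \<in> triangle a b \<Longrightarrow>
      ((\<lambda>s. f (s, y)) has_vector_derivative fx (x, y)) (at x within {y..b})"
    and "(x, y) \<in> triangle a b \<Longrightarrow>
      ((\<lambda>t. f (x, t)) has_vector_derivative fy (x, y)) (at y within {a..x})"
  using assms by (auto simp: has_triangle_partials_def)

lemma smooth_on_triangle_partials:
  assumes "smooth_on_triangle a b f"
  obtains fx fy where "has_triangle_partials a b f fx fy"
    "smooth_on_triangle a b fx" "smooth_on_triangle a b fy"
  using assms
proof (cases rule: smooth_on_triangle.cases)
  case (1 fx fy)
  then have "has_triangle_partials a b f fx fy"
    unfolding has_triangle_partials_def by blast
  with 1 show ?thesis by (blast intro: that)
qed

lemma smooth_on_triangleI: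
  assumes "has_triangle_partials a b f fx fy" "smooth_on_triangle a b fx" "smooth_on_triangle a b fy"
  shows "smooth_on_triangle a b f"
  using assms by (intro smooth_on_triangle.intros[of a b f fx fy]) (auto simp: has_triangle_partials_def)

text \<open>Coinduction in terms of a class of functions: smoothness is proved below by exhibiting a class that
contains partial derivatives of all its members.\<close>

lemma smooth_on_triangle_closed_class:
  assumes "f \<in> C"
    and step: "\<And>f. f \<in> C \<Longrightarrow> \<exists>fx\<in>C. \<exists>fy\<in>C. has_triangle_partials a b f fx fy"
  shows "smooth_on_triangle a b f"
  using assms(1)
proof (coinduction arbitrary: f)
  case smooth_on_triangle
  then obtain fx fy where "fx \<in> C" "fy \<in> C" "has_triangle_partials a b f fx fy"
    using step by blast
  then show ?case by (intro exI[of _ f] exI[of _ fx] exI[of _ fy]) (auto simp: has_triangle_partials_def)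
qed

lemma smooth_on_triangle_continuous: "smooth_on_triangle a b f \<Longrightarrow> continuous_on (triangle a b) f"
  by (erule smooth_on_triangle_partials) (rule has_triangle_partialsD(1))

lemma has_triangle_partials_cong:
  assumes f: "has_triangle_partials a b f fx fy" and eq: "\<And>p. p \<in> triangle a b \<Longrightarrow> g p = f p"
  shows "has_triangle_partials a b g fx fy"
  unfolding has_triangle_partials_def
proof (intro conjI allI impI)
  show "continuous_on (triangle a b) g"
    using has_triangle_partialsD(1)[OF f] eq by (simp cong: continuous_on_cong)
next
  fix x y assume xy: "(x, y) \<in> triangle a b"
  then show "((\<lambda>s. g (s, y)) has_vector_derivative fx (x, y)) (at x within {y..b})"
    by (intro has_vector_derivative_transform[OF _ _ has_triangle_partialsD(2)[OF f]] eq)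
      (auto simp: triangle_def)
  show "((\<lambda>t. g (x, t)) has_vector_derivative fy (x, y)) (at y within {a..x})"
    using xy by (intro has_vector_derivative_transform[OF _ _ has_triangle_partialsD(3)[OF f]] eq)
      (auto simp: triangle_def)
qed

lemma smooth_on_triangle_cong:
  assumes "smooth_on_triangle a b f" "\<And>p. p \<in> triangle a b \<Longrightarrow> g p = f p"
  shows "smooth_on_triangle a b g"
  using assms by (meson has_triangle_partials_cong smooth_on_triangleI smooth_on_triangle_partials)

lemma restrict_smooth_triangle:
  "smooth_on_triangle a b f \<Longrightarrow> restrict f (triangle a b) \<in> smooth_triangle a b"
  by (auto simp: smooth_triangle_def elim: smooth_on_triangle_cong)

lemma has_triangle_partials_const: "has_triangle_partials a b (\<lambda>_. c) (\<lambda>_. 0) (\<lambda>_. 0)"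
  by (simp add: has_triangle_partials_def)

lemma smooth_on_triangle_const: "smooth_on_triangle a b (\<lambda>_. c)"
  by (rule smooth_on_triangle_closed_class[of _ "range (\<lambda>c _. c)"])
    (auto intro: has_triangle_partials_const)

lemma has_triangle_partials_add:
  assumes "has_triangle_partials a b f fx fy" "has_triangle_partials a b g gx gy"
  shows "has_triangle_partials a b (\<lambda>p. f p + g p) (\<lambda>p. fx p + gx p) (\<lambda>p. fy p + gy p)"
  using assms by (auto simp: has_triangle_partials_def intro!: derivative_intros continuous_intros)

lemma smooth_on_triangle_add:
  assumes "smooth_on_triangle a b f" "smooth_on_triangle a b g"
  shows "smooth_on_triangle a b (\<lambda>p. f p + g p)"
proof (rule smooth_on_triangle_closed_class)
  let ?C = "{\<lambda>p. f p + g p | f g. smooth_on_triangle a b f \<and> smooth_on_triangle a b g}"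
  show "(\<lambda>p. f p + g p) \<in> ?C" using assms by blast
  fix h assume "h \<in> ?C"
  then obtain f g where h: "h = (\<lambda>p. f p + g p)" and fg: "smooth_on_triangle a b f" "smooth_on_triangle a b g"
    by blast
  obtain fx fy where f: "has_triangle_partials a b f fx fy" "smooth_on_triangle a b fx" "smooth_on_triangle a b fy"
    using fg(1) by (rule smooth_on_triangle_partials)
  obtain gx gy where g: "has_triangle_partials a b g gx gy" "smooth_on_triangle a b gx" "smooth_on_triangle a b gy"
    using fg(2) by (rule smooth_on_triangle_partials)
  show "\<exists>hx\<in>?C. \<exists>hy\<in>?C. has_triangle_partials a b h hx hy"
    using has_triangle_partials_add[OF f(1) g(1)] f g unfolding h by blast
qed

section \<open>Smooth functions on the interval\<close>

lemma deriv_interval_eqI: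
  assumes "a < b" "x \<in> {a..b}" "(F has_vector_derivative d) (at x within {a..b})"
  shows "deriv_interval a b F x = d"
  using assms vector_derivative_within_closed_interval by (simp add: deriv_interval_def)

text \<open>On the interval, too, smoothness and flatness are obtained from a class of functions that is closed under
differentiation. The class consists of arbitrary total functions; only the restriction to
\<open>[a,b]\<close> enters.\<close>

lemma iterated_deriv_closed_class:
  assumes ab: "a < b" and F: "F \<in> C"
    and step: "\<And>F. F \<in> C \<Longrightarrow>
      \<exists>G\<in>C. \<forall>x\<in>{a..b}. (F has_vector_derivative G x) (at x within {a..b})"
  shows "\<exists>G\<in>C. (deriv_interval a b ^^ k) (restrict F {a..b}) = restrict G {a..b}"
proof (induction k)
  case 0
  then show ?case using F by auto
next
  case (Suc k)
  then obtain G where G: "G \<in> C" "(deriv_interval a b ^^ k) (restrict F {a..b}) = restrict G {a..b}"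
    by blast
  obtain H where H: "H \<in> C" "\<And>x. x \<in> {a..b} \<Longrightarrow> (G has_vector_derivative H x) (at x within {a..b})"
    using step[OF G(1)] by blast
  have "deriv_interval a b (restrict G {a..b}) x = H x" if x: "x \<in> {a..b}" for x
    by (rule deriv_interval_eqI[OF ab x has_vector_derivative_transform[OF x _ H(2)[OF x]]]) simp
  then have "deriv_interval a b (restrict G {a..b}) = restrict H {a..b}"
    by (intro ext) (simp add: deriv_interval_def restrict_def)
  with H(1) G(2) show ?case by (auto simp del: restrict_apply)
qed

lemma smooth_interval_closed_class:
  assumes "a < b" "F \<in> C"
    and step: "\<And>F. F \<in> C \<Longrightarrow>
      \<exists>G\<in>C. \<forall>x\<in>{a..b}. (F has_vector_derivative G x) (at x within {a..b})"
  shows "restrict F {a..b} \<in> smooth_interval a b"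
proof -
  have "(deriv_interval a b ^^ k) (restrict F {a..b}) differentiable_on {a..b}" for k
  proof -
    obtain G where G: "G \<in> C" "(deriv_interval a b ^^ k) (restrict F {a..b}) = restrict G {a..b}"
      using iterated_deriv_closed_class[OF assms, where k = k] by blast
    obtain H where H: "\<And>x. x \<in> {a..b} \<Longrightarrow> (G has_vector_derivative H x) (at x within {a..b})"
      using step[OF G(1)] by blast
    have "(restrict G {a..b} has_vector_derivative H x) (at x within {a..b})" if x: "x \<in> {a..b}" for x
      by (rule has_vector_derivative_transform[OF x _ H[OF x]]) simp
    then show ?thesis
      unfolding G(2) differentiable_on_def by (blast intro: differentiableI_vector)
  qed
  then show ?thesis by (simp add: smooth_interval_def)
qed

lemma flat_functions_closed_class:
  assumes "a < b" "F \<in> C"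
    and "\<And>F. F \<in> C \<Longrightarrow>
      \<exists>G\<in>C. \<forall>x\<in>{a..b}. (F has_vector_derivative G x) (at x within {a..b})"
    and "\<And>F. F \<in> C \<Longrightarrow> F a = 0"
  shows "restrict F {a..b} \<in> flat_functions a b"
proof -
  have "(deriv_interval a b ^^ k) (restrict F {a..b}) a = 0" for k
    using iterated_deriv_closed_class[OF assms(1-3), where k = k] assms(1,4) by auto
  then show ?thesis
    using smooth_interval_closed_class[OF assms(1-3)] by (simp add: flat_functions_def)
qed

lemma smooth_interval_deriv:
  "P \<in> smooth_interval a b \<Longrightarrow> deriv_interval a b P \<in> smooth_interval a b"
proof -
  assume P: "P \<in> smooth_interval a b"
  have "(deriv_interval a b ^^ k) (deriv_interval a b P) differentiable_on {a..b}" for k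
  proof -
    have "(deriv_interval a b ^^ Suc k) P differentiable_on {a..b}"
      using P unfolding smooth_interval_def by blast
    then show ?thesis by (simp add: funpow_swap1)
  qed
  moreover have "deriv_interval a b P \<in> extensional {a..b}"
    by (simp add: deriv_interval_def)
  ultimately show ?thesis by (simp add: smooth_interval_def)
qed

lemma smooth_interval_has_vector_derivative:
  assumes "P \<in> smooth_interval a b" "x \<in> {a..b}"
  shows "(P has_vector_derivative deriv_interval a b P x) (at x within {a..b})"
proof -
  have "(deriv_interval a b ^^ 0) P differentiable_on {a..b}"
    using assms(1) unfolding smooth_interval_def by blast
  then show ?thesis
    using assms(2) by (simp add: differentiable_on_def vector_derivative_works deriv_interval_def)
qed

lemma smooth_interval_extensional: "P \<in> smooth_interval a b \<Longrightarrow> P \<in> extensional {a..b}"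
  by (simp add: smooth_interval_def)

lemma smooth_interval_continuous:
  "P \<in> smooth_interval a b \<Longrightarrow> continuous_on {a..b} P"
  by (meson continuous_on_eq_continuous_within has_vector_derivative_continuous
      smooth_interval_has_vector_derivative)

text \<open>The functions of this form are closed under differentiation. The Leibniz rule produces the
diagonal value \<open>g (x, x)\<close>, which is \<open>g (x, a)\<close> plus the integral of the partial derivative of \<open>g\<close> in
the second variable, hence again of this form.\<close>

lemma smooth_interval_edge_plus_integral:
  assumes ab: "a < b" and "smooth_on_triangle a b f" "smooth_on_triangle a b g"
  shows "(\<lambda>x\<in>{a..b}. f (x, a) + integral {a..x} (\<lambda>z. g (x, z))) \<in> smooth_interval a b"
proof (rule smooth_interval_closed_class[OF ab])
  let ?E = "\<lambda>f g x. f (x, a) + integral {a..x} (\<lambda>z. g (x, z))"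
  let ?C = "{?E f g | f g. smooth_on_triangle a b f \<and> smooth_on_triangle a b g}"
  show "?E f g \<in> ?C" using assms by blast
  fix F assume "F \<in> ?C"
  then obtain f g where F: "F = ?E f g" and fg: "smooth_on_triangle a b f" "smooth_on_triangle a b g"
    by blast
  obtain fx fy where f: "has_triangle_partials a b f fx fy" "smooth_on_triangle a b fx"
    using fg(1) by (rule smooth_on_triangle_partials)
  obtain gx gy where g: "has_triangle_partials a b g gx gy" "smooth_on_triangle a b gx" "smooth_on_triangle a b gy"
    using fg(2) by (rule smooth_on_triangle_partials)
  show "\<exists>G\<in>?C. \<forall>x\<in>{a..b}. (F has_vector_derivative G x) (at x within {a..b})"
  proof (intro bexI ballI)
    show "?E (\<lambda>p. fx p + g p) (\<lambda>p. gx p + gy p) \<in> ?C"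
      by (intro CollectI exI[of _ "\<lambda>p. fx p + g p"] exI[of _ "\<lambda>p. gx p + gy p"] conjI refl
          smooth_on_triangle_add f g fg)
    fix x assume x: "x \<in> {a..b}"
    have "((\<lambda>s. f (s, a)) has_vector_derivative fx (x, a)) (at x within {a..b})"
      using has_triangle_partialsD(2)[OF f(1), of x a] x by (simp add: triangle_iff)
    moreover have "((\<lambda>s. integral {a..s} (\<lambda>z. g (s, z))) has_vector_derivative
        g (x, x) + integral {a..x} (\<lambda>z. gx (x, z))) (at x within {a..b})"
      by (intro triangle_integral_has_vector_derivative smooth_on_triangle_continuous fg g x
          has_triangle_partialsD(2)[OF g(1)])
    moreover have "integral {a..x} (\<lambda>z. gy (x, z)) = g (x, x) - g (x, a)"
      by (intro integral_unique fundamental_theorem_of_calculus has_triangle_partialsD(3)[OF g(1)])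
        (use x in \<open>auto simp: triangle_iff\<close>)
    moreover have "integral {a..x} (\<lambda>z. gx (x, z) + gy (x, z)) =
        integral {a..x} (\<lambda>z. gx (x, z)) + integral {a..x} (\<lambda>z. gy (x, z))"
      by (intro integral_add integrable_continuous_real continuous_on_triangle_section[OF _ x]
          smooth_on_triangle_continuous g)
    ultimately show "(F has_vector_derivative ?E (\<lambda>p. fx p + g p) (\<lambda>p. gx p + gy p) x) (at x within {a..b})"
      unfolding F by (auto intro!: derivative_eq_intros)
  qed
qed

lemma smooth_interval_edge:
  assumes "a < b" "smooth_on_triangle a b f"
  shows "(\<lambda>x\<in>{a..b}. f (x, a)) \<in> smooth_interval a b"
  using smooth_interval_edge_plus_integral[OF assms smooth_on_triangle_const[of _ _ 0]] by simp

text \<open>By the fundamental theorem of calculus \<open>f (x, x)\<close> is the edge value \<open>f (x, a)\<close> plus an integral along the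
vertical section.\<close>

lemma smooth_interval_diagonal:
  assumes ab: "a < b" and f: "smooth_on_triangle a b f"
  shows "(\<lambda>x\<in>{a..b}. f (x, x)) \<in> smooth_interval a b"
proof -
  obtain fx fy where p: "has_triangle_partials a b f fx fy" "smooth_on_triangle a b fy"
    using f by (rule smooth_on_triangle_partials)
  have "integral {a..x} (\<lambda>z. fy (x, z)) = f (x, x) - f (x, a)" if x: "x \<in> {a..b}" for x
    by (intro integral_unique fundamental_theorem_of_calculus has_triangle_partialsD(3)[OF p(1)])
      (use x in \<open>auto simp: triangle_iff\<close>)
  then have "(\<lambda>x\<in>{a..b}. f (x, x)) = (\<lambda>x\<in>{a..b}. f (x, a) + integral {a..x} (\<lambda>z. fy (x, z)))"
    by auto
  then show ?thesis using smooth_interval_edge_plus_integral[OF ab f p(2)] by simp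
qed

section \<open>Products and convolutions of smooth functions\<close>

text \<open>The derivative of a product is a sum of products, and that of a convolution also involves diagonal values
of the factors, so neither products nor convolutions alone are closed under partial differentiation. This
set contains everything that arises. Convolution takes only factors already known to be smooth, so that
their diagonals are smooth functions on the interval.\<close>

inductive_set triangle_algebra :: "real \<Rightarrow> real \<Rightarrow> (real \<times> real \<Rightarrow> complex) set" for a b where
  base: "smooth_on_triangle a b f \<Longrightarrow> f \<in> triangle_algebra a b"
| pull_x: "P \<in> smooth_interval a b \<Longrightarrow> (\<lambda>p. P (fst p)) \<in> triangle_algebra a b"
| pull_y: "P \<in> smooth_interval a b \<Longrightarrow> (\<lambda>p. P (snd p)) \<in> triangle_algebra a b"
| conv: "smooth_on_triangle a b f \<Longrightarrow> smooth_on_triangle a b g \<Longrightarrow>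
    (\<lambda>(x, y). integral {y..x} (\<lambda>z. f (x, z) * g (z, y))) \<in> triangle_algebra a b"
| add: "f \<in> triangle_algebra a b \<Longrightarrow> g \<in> triangle_algebra a b \<Longrightarrow>
    (\<lambda>p. f p + g p) \<in> triangle_algebra a b"
| mult: "f \<in> triangle_algebra a b \<Longrightarrow> g \<in> triangle_algebra a b \<Longrightarrow>
    (\<lambda>p. f p * g p) \<in> triangle_algebra a b"

text \<open>For fixed \<open>y\<close> the first variable is the upper limit, on the triangle over \<open>[y,b]\<close>; for fixed \<open>x\<close> the second one is the
lower limit, on the triangle over \<open>[a,x]\<close>. The two Leibniz rules apply.\<close>

lemma has_triangle_partials_conv:
  assumes f: "has_triangle_partials a b f fx fy" and fx: "continuous_on (triangle a b) fx"
    and g: "has_triangle_partials a b g gx gy" and gy: "continuous_on (triangle a b) gy"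
  shows "has_triangle_partials a b (\<lambda>(x, y). integral {y..x} (\<lambda>z. f (x, z) * g (z, y)))
    (\<lambda>(x, y). f (x, x) * g (x, y) + integral {y..x} (\<lambda>z. fx (x, z) * g (z, y)))
    (\<lambda>(x, y). integral {y..x} (\<lambda>z. f (x, z) * gy (z, y)) - f (x, y) * g (y, y))"
  unfolding has_triangle_partials_def
proof (intro conjI allI impI)
  note fc = has_triangle_partialsD(1)[OF f] and gc = has_triangle_partialsD(1)[OF g]
  show "continuous_on (triangle a b) (\<lambda>(x, y). integral {y..x} (\<lambda>z. f (x, z) * g (z, y)))"
    by (rule continuous_on_triangle_integral[of a b "\<lambda>p z. f (fst p, z) * g (z, snd p)", simplified])
      (auto simp: case_prod_unfold triangle_def
        intro!: continuous_on_compose2[OF fc] continuous_on_compose2[OF gc] continuous_intros)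
  fix x y assume xy: "(x, y) \<in> triangle a b"
  have sub: "triangle y b \<subseteq> triangle a b" "triangle a x \<subseteq> triangle a b"
    using xy by (auto simp: triangle_def)
  have row: "continuous_on (triangle y b) (\<lambda>(x, z). k (x, z) * g (z, y))"
    if k: "continuous_on (triangle a b) k" for k
    using xy by (auto simp: case_prod_unfold triangle_def intro!: continuous_on_compose2[OF k]
        continuous_on_compose2[OF gc] continuous_intros)
  have column: "continuous_on (triangle a x) (\<lambda>(z, y). f (x, z) * k (z, y))"
    if k: "continuous_on (triangle a b) k" for k
    using xy by (auto simp: case_prod_unfold triangle_def intro!: continuous_on_compose2[OF k]
        continuous_on_compose2[OF fc] continuous_intros)
  have "((\<lambda>s. integral {y..s} (\<lambda>z. (\<lambda>(x, z). f (x, z) * g (z, y)) (s, z))) has_vector_derivative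
      (\<lambda>(x, z). f (x, z) * g (z, y)) (x, x) +
      integral {y..x} (\<lambda>z. (\<lambda>(x, z). fx (x, z) * g (z, y)) (x, z))) (at x within {y..b})"
  proof (rule triangle_integral_has_vector_derivative[OF row[OF fc] row[OF fx]])
    fix s z assume "(s, z) \<in> triangle y b"
    then have "((\<lambda>s. f (s, z)) has_vector_derivative fx (s, z)) (at s within {z..b})"
      using has_triangle_partialsD(2)[OF f] sub by blast
    then show "((\<lambda>s. (\<lambda>(x, z). f (x, z) * g (z, y)) (s, z)) has_vector_derivative
        (\<lambda>(x, z). fx (x, z) * g (z, y)) (s, z)) (at s within {z..b})"
      by (auto intro!: derivative_eq_intros)
  qed (use xy in \<open>auto simp: triangle_iff\<close>)
  then show "((\<lambda>s. (\<lambda>(x, y). integral {y..x} (\<lambda>z. f (x, z) * g (z, y))) (s, y)) has_vector_derivative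
      (\<lambda>(x, y). f (x, x) * g (x, y) + integral {y..x} (\<lambda>z. fx (x, z) * g (z, y))) (x, y))
      (at x within {y..b})"
    by simp
  have "((\<lambda>t. integral {t..x} (\<lambda>z. f (x, z) * g (z, t))) has_vector_derivative
      integral {y..x} (\<lambda>z. f (x, z) * gy (z, y)) - f (x, y) * g (y, y)) (at y within {a..x})"
  proof (rule triangle_integral_has_vector_derivative_lower[OF column[OF gc] column[OF gy]])
    fix z t assume "(z, t) \<in> triangle a x"
    then have "((\<lambda>t. g (z, t)) has_vector_derivative gy (z, t)) (at t within {a..z})"
      using has_triangle_partialsD(3)[OF g] sub by blast
    then show "((\<lambda>t. f (x, z) * g (z, t)) has_vector_derivative f (x, z) * gy (z, t)) (at t within {a..z})"
      by (auto intro!: derivative_eq_intros)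
  qed (use xy in \<open>auto simp: triangle_iff\<close>)
  then show "((\<lambda>t. (\<lambda>(x, y). integral {y..x} (\<lambda>z. f (x, z) * g (z, y))) (x, t)) has_vector_derivative
      (\<lambda>(x, y). integral {y..x} (\<lambda>z. f (x, z) * gy (z, y)) - f (x, y) * g (y, y)) (x, y))
      (at y within {a..x})"
    by simp
qed

lemma has_triangle_partials_mult:
  assumes "has_triangle_partials a b f fx fy" "has_triangle_partials a b g gx gy"
  shows "has_triangle_partials a b (\<lambda>p. f p * g p)
    (\<lambda>p. f p * gx p + fx p * g p) (\<lambda>p. f p * gy p + fy p * g p)"
  using assms by (auto simp: has_triangle_partials_def intro!: derivative_intros continuous_intros)

lemma has_triangle_partials_pull:
  assumes P: "P \<in> smooth_interval a b"
  shows "has_triangle_partials a b (\<lambda>p. P (fst p)) (\<lambda>p. deriv_interval a b P (fst p)) (\<lambda>_. 0)"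
    and "has_triangle_partials a b (\<lambda>p. P (snd p)) (\<lambda>_. 0) (\<lambda>p. deriv_interval a b P (snd p))"
proof -
  note d = smooth_interval_has_vector_derivative[OF P]
  show "has_triangle_partials a b (\<lambda>p. P (fst p)) (\<lambda>p. deriv_interval a b P (fst p)) (\<lambda>_. 0)"
    "has_triangle_partials a b (\<lambda>p. P (snd p)) (\<lambda>_. 0) (\<lambda>p. deriv_interval a b P (snd p))"
    unfolding has_triangle_partials_def
    by (auto simp: triangle_def intro!: has_vector_derivative_within_subset[OF d]
        continuous_on_compose2[OF smooth_interval_continuous[OF P]] continuous_intros)
qed

lemma triangle_algebra_partials:
  assumes ab: "a < b" and "f \<in> triangle_algebra a b"
  shows "\<exists>fx\<in>triangle_algebra a b. \<exists>fy\<in>triangle_algebra a b. has_triangle_partials a b f fx fy"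
  using assms(2)
proof induction
  case (base f)
  then show ?case by (metis smooth_on_triangle_partials triangle_algebra.base)
next
  case (pull_x P)
  then show ?case
    using has_triangle_partials_pull(1)[OF pull_x] triangle_algebra.pull_x[OF smooth_interval_deriv[OF pull_x]]
      triangle_algebra.base[OF smooth_on_triangle_const[of a b 0]] by blast
next
  case (pull_y P)
  then show ?case
    using has_triangle_partials_pull(2)[OF pull_y] triangle_algebra.pull_y[OF smooth_interval_deriv[OF pull_y]]
      triangle_algebra.base[OF smooth_on_triangle_const[of a b 0]] by blast
next
  case (add f g)
  then obtain fx fy gx gy where p: "has_triangle_partials a b f fx fy" "has_triangle_partials a b g gx gy"
    and "fx \<in> triangle_algebra a b" "fy \<in> triangle_algebra a b"
      "gx \<in> triangle_algebra a b" "gy \<in> triangle_algebra a b" by blast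
  then have "(\<lambda>p. fx p + gx p) \<in> triangle_algebra a b" "(\<lambda>p. fy p + gy p) \<in> triangle_algebra a b"
    by (auto intro: triangle_algebra.add)
  with has_triangle_partials_add[OF p] show ?case by blast
next
  case (mult f g)
  then obtain fx fy gx gy where p: "has_triangle_partials a b f fx fy" "has_triangle_partials a b g gx gy"
    and "fx \<in> triangle_algebra a b" "fy \<in> triangle_algebra a b"
      "gx \<in> triangle_algebra a b" "gy \<in> triangle_algebra a b" by blast
  then have "(\<lambda>p. f p * gx p + fx p * g p) \<in> triangle_algebra a b"
    "(\<lambda>p. f p * gy p + fy p * g p) \<in> triangle_algebra a b"
    by (auto intro!: triangle_algebra.add triangle_algebra.mult mult.hyps)
  with has_triangle_partials_mult[OF p] show ?case by blast
next
  case (conv f g)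
  obtain fx fy where f: "has_triangle_partials a b f fx fy" "smooth_on_triangle a b fx"
    using conv(1) by (rule smooth_on_triangle_partials)
  obtain gx gy where g: "has_triangle_partials a b g gx gy" "smooth_on_triangle a b gy"
    using conv(2) by (rule smooth_on_triangle_partials)
  let ?conv = "\<lambda>f g p. (\<lambda>(x, y). integral {y..x} (\<lambda>z. f (x, z) * g (z, y))) p"
  let ?diag = "\<lambda>f. \<lambda>x\<in>{a..b}. f (x, x)"
  let ?kx = "\<lambda>p. ?diag f (fst p) * g p + ?conv fx g p"
  let ?ky = "\<lambda>p. ?conv f gy p + (- 1) * (f p * ?diag g (snd p))"
  have "?kx \<in> triangle_algebra a b"
    by (intro triangle_algebra.add triangle_algebra.mult triangle_algebra.pull_x
        smooth_interval_diagonal triangle_algebra.base triangle_algebra.conv ab conv f)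
  moreover have "?ky \<in> triangle_algebra a b"
    by (intro triangle_algebra.add triangle_algebra.mult triangle_algebra.pull_y smooth_on_triangle_const
        smooth_interval_diagonal triangle_algebra.base triangle_algebra.conv ab conv g)
  moreover have "has_triangle_partials a b (?conv f g) ?kx ?ky"
    using has_triangle_partials_conv[OF f(1) smooth_on_triangle_continuous[OF f(2)]
        g(1) smooth_on_triangle_continuous[OF g(2)]]
    by (simp add: has_triangle_partials_def triangle_def)
  ultimately show ?case by (intro bexI)
qed

lemma triangle_algebra_smooth:
  "a < b \<Longrightarrow> f \<in> triangle_algebra a b \<Longrightarrow> smooth_on_triangle a b f"
  by (rule smooth_on_triangle_closed_class[OF _ triangle_algebra_partials])

lemma smooth_on_triangle_mult:
  "a < b \<Longrightarrow> smooth_on_triangle a b f \<Longrightarrow> smooth_on_triangle a b g \<Longrightarrow> smooth_on_triangle a b (\<lambda>p. f p * g p)"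
  by (rule triangle_algebra_smooth[OF _ triangle_algebra.mult[OF triangle_algebra.base triangle_algebra.base]])

lemma smooth_on_triangle_fst:
  "a < b \<Longrightarrow> P \<in> smooth_interval a b \<Longrightarrow> smooth_on_triangle a b (\<lambda>p. P (fst p))"
  by (rule triangle_algebra_smooth[OF _ triangle_algebra.pull_x])

lemma smooth_on_triangle_snd:
  "a < b \<Longrightarrow> P \<in> smooth_interval a b \<Longrightarrow> smooth_on_triangle a b (\<lambda>p. P (snd p))"
  by (rule triangle_algebra_smooth[OF _ triangle_algebra.pull_y])

lemma smooth_on_triangle_conv:
  "a < b \<Longrightarrow> smooth_on_triangle a b f \<Longrightarrow> smooth_on_triangle a b g \<Longrightarrow>
    smooth_on_triangle a b (\<lambda>(x, y). integral {y..x} (\<lambda>z. f (x, z) * g (z, y)))"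
  by (rule triangle_algebra_smooth[OF _ triangle_algebra.conv])

lemma smooth_interval_const: "a < b \<Longrightarrow> (\<lambda>x\<in>{a..b}. c) \<in> smooth_interval a b"
  using smooth_interval_edge[OF _ smooth_on_triangle_const] by simp

lemma smooth_interval_add:
  "a < b \<Longrightarrow> P \<in> smooth_interval a b \<Longrightarrow> Q \<in> smooth_interval a b \<Longrightarrow> (\<lambda>x\<in>{a..b}. P x + Q x) \<in> smooth_interval a b"
  using smooth_interval_edge[OF _ smooth_on_triangle_add[OF smooth_on_triangle_fst smooth_on_triangle_fst]]
  by simp

lemma smooth_interval_mult:
  "a < b \<Longrightarrow> P \<in> smooth_interval a b \<Longrightarrow> Q \<in> smooth_interval a b \<Longrightarrow> (\<lambda>x\<in>{a..b}. P x * Q x) \<in> smooth_interval a b"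
  using smooth_interval_edge[OF _ smooth_on_triangle_mult[OF _ smooth_on_triangle_fst smooth_on_triangle_fst]]
  by simp

section \<open>Flat functions\<close>

lemma flat_functionsD:
  assumes "\<phi> \<in> flat_functions a b"
  shows flat_functions_smooth: "\<phi> \<in> smooth_interval a b"
    and flat_functions_zero: "\<phi> a = 0"
    and flat_functions_deriv: "deriv_interval a b \<phi> \<in> flat_functions a b"
proof -
  have flat: "(deriv_interval a b ^^ k) \<phi> a = 0" for k
    using assms by (simp add: flat_functions_def)
  show s: "\<phi> \<in> smooth_interval a b" using assms by (simp add: flat_functions_def)
  show "\<phi> a = 0" using flat[of 0] by simp
  have "(deriv_interval a b ^^ k) (deriv_interval a b \<phi>) a = 0" for k
    using flat[of "Suc k"] by (simp add: funpow_swap1)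
  then show "deriv_interval a b \<phi> \<in> flat_functions a b"
    using smooth_interval_deriv[OF s] by (simp add: flat_functions_def)
qed

lemma flat_functions_deriv_iterated:
  "\<phi> \<in> flat_functions a b \<Longrightarrow> (deriv_interval a b ^^ i) \<phi> \<in> flat_functions a b"
  by (induction i) (auto intro: flat_functions_deriv)

lemma flat_functions_extensional: "\<phi> \<in> flat_functions a b \<Longrightarrow> \<phi> \<in> extensional {a..b}"
  by (simp add: flat_functions_def smooth_interval_def)

lemma flat_functions_has_vector_derivative:
  "\<phi> \<in> flat_functions a b \<Longrightarrow> x \<in> {a..b} \<Longrightarrow>
    (\<phi> has_vector_derivative deriv_interval a b \<phi> x) (at x within {a..b})"
  by (rule smooth_interval_has_vector_derivative[OF flat_functions_smooth])

lemma flat_functions_continuous: "\<phi> \<in> flat_functions a b \<Longrightarrow> continuous_on {a..b} \<phi>"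
  by (rule smooth_interval_continuous[OF flat_functions_smooth])

lemma volterra_continuous:
  fixes f :: "real \<times> real \<Rightarrow> complex"
  assumes "continuous_on (triangle a b) f" "continuous_on {a..b} \<phi>" "x \<in> {a..b}"
  shows "continuous_on {a..x} (\<lambda>z. f (x, z) * \<phi> z)"
proof (rule continuous_on_mult)
  show "continuous_on {a..x} (\<lambda>z. f (x, z))"
    by (rule continuous_on_triangle_section[OF assms(1,3)])
  show "continuous_on {a..x} \<phi>"
    using assms(3) by (intro continuous_on_subset[OF assms(2)]) auto
qed

text \<open>On operators this says that the derivative composed with a Volterra operator is multiplication by the
diagonal of the kernel plus the Volterra operator of the differentiated kernel.\<close>

lemma volterra_has_vector_derivative:
  assumes f: "has_triangle_partials a b f fx fy" "continuous_on (triangle a b) fx"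
    and \<phi>: "continuous_on {a..b} \<phi>" and x: "x \<in> {a..b}"
  shows "((\<lambda>s. integral {a..s} (\<lambda>z. f (s, z) * \<phi> z)) has_vector_derivative
    f (x, x) * \<phi> x + integral {a..x} (\<lambda>z. fx (x, z) * \<phi> z)) (at x within {a..b})"
proof -
  have c: "continuous_on (triangle a b) (\<lambda>p. k p * \<phi> (snd p))" if "continuous_on (triangle a b) k" for k
    by (intro continuous_intros that continuous_on_compose2[OF \<phi>]) (auto simp: triangle_def)
  have "((\<lambda>s. integral {a..s} (\<lambda>z. (\<lambda>p. f p * \<phi> (snd p)) (s, z))) has_vector_derivative
      (\<lambda>p. f p * \<phi> (snd p)) (x, x) + integral {a..x} (\<lambda>z. (\<lambda>p. fx p * \<phi> (snd p)) (x, z)))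
      (at x within {a..b})"
  proof (rule triangle_integral_has_vector_derivative[OF c c])
    fix s z assume "(s, z) \<in> triangle a b"
    from has_triangle_partialsD(2)[OF f(1) this]
    show "((\<lambda>s. f (s, z) * \<phi> (snd (s, z))) has_vector_derivative fx (s, z) * \<phi> (snd (s, z)))
        (at s within {z..b})"
      by (auto intro!: derivative_eq_intros)
  qed (use has_triangle_partialsD(1)[OF f(1)] f(2) x in auto)
  then show ?thesis by simp
qed

text \<open>The functions that arise when products and Volterra integrals of flat functions are differentiated. All of
them vanish at \<open>a\<close>, so all of them are flat.\<close>

inductive_set flat_closure :: "real \<Rightarrow> real \<Rightarrow> (real \<Rightarrow> complex) set" for a b where
  base: "\<phi> \<in> flat_functions a b \<Longrightarrow> \<phi> \<in> flat_closure a b"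
| add: "\<phi> \<in> flat_closure a b \<Longrightarrow> \<psi> \<in> flat_closure a b \<Longrightarrow> (\<lambda>x. \<phi> x + \<psi> x) \<in> flat_closure a b"
| mult: "P \<in> smooth_interval a b \<Longrightarrow> \<phi> \<in> flat_closure a b \<Longrightarrow> (\<lambda>x. P x * \<phi> x) \<in> flat_closure a b"
| volterra: "smooth_on_triangle a b f \<Longrightarrow> \<phi> \<in> flat_functions a b \<Longrightarrow>
    (\<lambda>x. integral {a..x} (\<lambda>z. f (x, z) * \<phi> z)) \<in> flat_closure a b"

lemma flat_closure_deriv:
  assumes ab: "a < b" and "F \<in> flat_closure a b"
  shows "\<exists>G\<in>flat_closure a b. \<forall>x\<in>{a..b}. (F has_vector_derivative G x) (at x within {a..b})"
  using assms(2)
proof induction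
  case (base \<phi>)
  then show ?case
    using flat_functions_deriv flat_functions_has_vector_derivative flat_closure.base by blast
next
  case (add \<phi> \<psi>)
  then obtain \<phi>' \<psi>' where "\<phi>' \<in> flat_closure a b" "\<psi>' \<in> flat_closure a b"
    and d: "\<forall>x\<in>{a..b}. (\<phi> has_vector_derivative \<phi>' x) (at x within {a..b})"
      "\<forall>x\<in>{a..b}. (\<psi> has_vector_derivative \<psi>' x) (at x within {a..b})" by blast
  then show ?case
    by (intro bexI[of _ "\<lambda>x. \<phi>' x + \<psi>' x"] flat_closure.add) (auto intro: derivative_intros)
next
  case (mult P \<phi>)
  then obtain \<phi>' where "\<phi>' \<in> flat_closure a b"
    and d: "\<forall>x\<in>{a..b}. (\<phi> has_vector_derivative \<phi>' x) (at x within {a..b})" by blast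
  moreover note mult.hyps smooth_interval_deriv[OF mult.hyps(1)]
  ultimately show ?case
    using smooth_interval_has_vector_derivative[OF mult.hyps(1)]
    by (intro bexI[of _ "\<lambda>x. P x * \<phi>' x + deriv_interval a b P x * \<phi> x"] flat_closure.add flat_closure.mult)
      (auto intro: derivative_intros)
next
  case (volterra f \<phi>)
  obtain fx fy where f: "has_triangle_partials a b f fx fy" "smooth_on_triangle a b fx"
    using volterra(1) by (rule smooth_on_triangle_partials)
  let ?G = "\<lambda>x. (\<lambda>x\<in>{a..b}. f (x, x)) x * \<phi> x + integral {a..x} (\<lambda>z. fx (x, z) * \<phi> z)"
  have "?G \<in> flat_closure a b"
    by (intro flat_closure.add flat_closure.mult flat_closure.base flat_closure.volterra
        smooth_interval_diagonal ab volterra f)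
  then show ?case
    using volterra_has_vector_derivative[OF f(1) smooth_on_triangle_continuous[OF f(2)]
        flat_functions_continuous[OF volterra(2)]]
    by (intro bexI[of _ ?G]) simp_all
qed

lemma flat_closure_flat:
  assumes "a < b" "F \<in> flat_closure a b"
  shows "restrict F {a..b} \<in> flat_functions a b"
  by (rule flat_functions_closed_class[OF assms flat_closure_deriv[OF assms(1)]], assumption)
    (erule flat_closure.induct; simp add: flat_functions_zero)

lemma flat_functions_add:
  "a < b \<Longrightarrow> \<phi> \<in> flat_functions a b \<Longrightarrow> \<psi> \<in> flat_functions a b \<Longrightarrow>
    (\<lambda>x\<in>{a..b}. \<phi> x + \<psi> x) \<in> flat_functions a b"
  by (simp add: flat_closure_flat flat_closure.base flat_closure.add)

lemma flat_functions_mult: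
  "a < b \<Longrightarrow> P \<in> smooth_interval a b \<Longrightarrow> \<phi> \<in> flat_functions a b \<Longrightarrow>
    (\<lambda>x\<in>{a..b}. P x * \<phi> x) \<in> flat_functions a b"
  by (simp add: flat_closure_flat flat_closure.base flat_closure.mult)

lemma flat_functions_volterra:
  "a < b \<Longrightarrow> smooth_on_triangle a b f \<Longrightarrow> \<phi> \<in> flat_functions a b \<Longrightarrow>
    (\<lambda>x\<in>{a..b}. integral {a..x} (\<lambda>z. f (x, z) * \<phi> z)) \<in> flat_functions a b"
  by (simp add: flat_closure_flat flat_closure.volterra)

section \<open>Composition of operators in normal form\<close>

definition op_monomial :: "real \<Rightarrow> real \<Rightarrow> (real \<Rightarrow> complex) \<Rightarrow> nat \<Rightarrow> operator" where
  "op_monomial a b P i = (\<lambda>\<phi>\<in>flat_functions a b. \<lambda>x\<in>{a..b}. P x * (deriv_interval a b ^^ i) \<phi> x)"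

text \<open>The operators that have a normal form, generated by addition so that composition can be
studied on single summands.\<close>

inductive_set normal_ops :: "real \<Rightarrow> real \<Rightarrow> operator set" for a b :: real where
  monomial: "P \<in> smooth_interval a b \<Longrightarrow> op_monomial a b P i \<in> normal_ops a b"
| volterra: "smooth_on_triangle a b f \<Longrightarrow> op_volterra a b f \<in> normal_ops a b"
| add: "S \<in> normal_ops a b \<Longrightarrow> T \<in> normal_ops a b \<Longrightarrow> op_add a b S T \<in> normal_ops a b"

lemma normal_ops_flat:
  assumes ab: "a < b" and "T \<in> normal_ops a b" and \<phi>: "\<phi> \<in> flat_functions a b"
  shows "T \<phi> \<in> flat_functions a b"
  using assms(2)
  by induction (simp_all add: op_monomial_def op_volterra_def op_add_def \<phi> ab flat_functions_mult
      flat_functions_volterra flat_functions_add flat_functions_deriv_iterated restrict_apply' del: restrict_apply)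

lemma operator_eqI:
  assumes "S \<in> extensional (flat_functions a b)" "T \<in> extensional (flat_functions a b)"
    and "\<And>\<phi>. \<phi> \<in> flat_functions a b \<Longrightarrow> S \<phi> \<in> extensional {a..b}"
    and "\<And>\<phi>. \<phi> \<in> flat_functions a b \<Longrightarrow> T \<phi> \<in> extensional {a..b}"
    and "\<And>\<phi> x. \<phi> \<in> flat_functions a b \<Longrightarrow> x \<in> {a..b} \<Longrightarrow> S \<phi> x = T \<phi> x"
  shows "S = T"
proof (rule extensionalityI[OF assms(1,2)])
  fix \<phi> assume \<phi>: "\<phi> \<in> flat_functions a b"
  show "S \<phi> = T \<phi>"
    by (rule extensionalityI[OF assms(3,4,5)[OF \<phi>]])
qed

lemma op_extensional [simp]:
  "op_mult a b P \<in> extensional (flat_functions a b)"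
  "op_deriv a b \<in> extensional (flat_functions a b)"
  "op_volterra a b f \<in> extensional (flat_functions a b)"
  "op_add a b S T \<in> extensional (flat_functions a b)"
  "op_scale a b c T \<in> extensional (flat_functions a b)"
  "op_monomial a b P i \<in> extensional (flat_functions a b)"
  by (simp_all add: op_mult_def op_deriv_def op_volterra_def op_add_def op_scale_def op_monomial_def)

lemma compose_op_add:
  assumes ab: "a < b" and ST: "S \<in> normal_ops a b" "T \<in> normal_ops a b"
    and G: "\<And>\<phi> \<psi>. \<phi> \<in> flat_functions a b \<Longrightarrow> \<psi> \<in> flat_functions a b \<Longrightarrow>
      G (\<lambda>x\<in>{a..b}. \<phi> x + \<psi> x) = (\<lambda>x\<in>{a..b}. G \<phi> x + G \<psi> x)"
  shows "compose (flat_functions a b) G (op_add a b S T) =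
    op_add a b (compose (flat_functions a b) G S) (compose (flat_functions a b) G T)"
  by (rule extensionalityI[of _ "flat_functions a b"])
    (simp_all add: compose_def op_add_def G normal_ops_flat[OF ab] ST)

lemma normal_ops_mult:
  assumes ab: "a < b" and P: "P \<in> smooth_interval a b" and "T \<in> normal_ops a b"
  shows "compose (flat_functions a b) (op_mult a b P) T \<in> normal_ops a b"
  using assms(3)
proof induction
  case (monomial Q i)
  have "compose (flat_functions a b) (op_mult a b P) (op_monomial a b Q i) = op_monomial a b (\<lambda>x\<in>{a..b}. P x * Q x) i"
    using normal_ops_flat[OF ab normal_ops.monomial[OF monomial]]
    by (intro operator_eqI[of _ a b]) (simp_all add: compose_def op_mult_def op_monomial_def)
  then show ?case using smooth_interval_mult[OF ab P monomial] by (simp add: normal_ops.monomial)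
next
  case (volterra f)
  have "compose (flat_functions a b) (op_mult a b P) (op_volterra a b f) = op_volterra a b (\<lambda>p. P (fst p) * f p)"
    using normal_ops_flat[OF ab normal_ops.volterra[OF volterra]]
    by (intro operator_eqI[of _ a b]) (simp_all add: compose_def op_mult_def op_volterra_def mult.assoc)
  then show ?case
    using smooth_on_triangle_mult[OF ab smooth_on_triangle_fst[OF ab P] volterra] by (simp add: normal_ops.volterra)
next
  case (add S T)
  have "compose (flat_functions a b) (op_mult a b P) (op_add a b S T) =
      op_add a b (compose (flat_functions a b) (op_mult a b P) S) (compose (flat_functions a b) (op_mult a b P) T)"
    by (rule compose_op_add[OF ab add.hyps])
      (auto simp: op_mult_def flat_functions_add[OF ab] algebra_simps)
  then show ?case using add.IH by (simp add: normal_ops.add)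
qed

text \<open>Product rule for a differential monomial, Leibniz rule for a Volterra operator.\<close>

lemma normal_ops_deriv:
  assumes ab: "a < b" and "T \<in> normal_ops a b"
  shows "compose (flat_functions a b) (op_deriv a b) T \<in> normal_ops a b"
  using assms(2)
proof induction
  case (monomial P i)
  have d: "deriv_interval a b (\<lambda>x\<in>{a..b}. P x * (deriv_interval a b ^^ i) \<phi> x) x =
      P x * (deriv_interval a b ^^ Suc i) \<phi> x + deriv_interval a b P x * (deriv_interval a b ^^ i) \<phi> x"
    if \<phi>: "\<phi> \<in> flat_functions a b" and x: "x \<in> {a..b}" for \<phi> x
    using flat_functions_has_vector_derivative[OF flat_functions_deriv_iterated[OF \<phi>, of i] x]
      smooth_interval_has_vector_derivative[OF monomial x]
    by (intro deriv_interval_eqI[OF ab x] has_vector_derivative_transform[OF x restrict_apply'])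
      (auto intro!: derivative_eq_intros)
  have "compose (flat_functions a b) (op_deriv a b) (op_monomial a b P i) =
      op_add a b (op_monomial a b P (Suc i)) (op_monomial a b (deriv_interval a b P) i)"
    using normal_ops_flat[OF ab normal_ops.monomial[OF monomial]] d
    by (intro operator_eqI[of _ a b]) (simp_all add: compose_def op_deriv_def op_monomial_def op_add_def deriv_interval_def)
  then show ?case using smooth_interval_deriv[OF monomial] monomial by (simp add: normal_ops.intros)
next
  case (volterra f)
  obtain fx fy where f: "has_triangle_partials a b f fx fy" "smooth_on_triangle a b fx"
    using volterra by (rule smooth_on_triangle_partials)
  have d: "deriv_interval a b (\<lambda>x\<in>{a..b}. integral {a..x} (\<lambda>z. f (x, z) * \<phi> z)) x =
      f (x, x) * \<phi> x + integral {a..x} (\<lambda>z. fx (x, z) * \<phi> z)"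
    if \<phi>: "\<phi> \<in> flat_functions a b" and x: "x \<in> {a..b}" for \<phi> x
    using volterra_has_vector_derivative[OF f(1) smooth_on_triangle_continuous[OF f(2)]
        flat_functions_continuous[OF \<phi>] x]
    by (intro deriv_interval_eqI[OF ab x] has_vector_derivative_transform[OF x restrict_apply'])
  have "compose (flat_functions a b) (op_deriv a b) (op_volterra a b f) =
      op_add a b (op_monomial a b (\<lambda>x\<in>{a..b}. f (x, x)) 0) (op_volterra a b fx)"
    using normal_ops_flat[OF ab normal_ops.volterra[OF volterra]] d
    by (intro operator_eqI[of _ a b])
      (simp_all add: compose_def op_deriv_def op_monomial_def op_add_def op_volterra_def deriv_interval_def)
  then show ?case
    using smooth_interval_diagonal[OF ab volterra] f(2) by (simp add: normal_ops.intros)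
next
  case (add S T)
  have d: "deriv_interval a b (\<lambda>x\<in>{a..b}. \<phi> x + \<psi> x) x = deriv_interval a b \<phi> x + deriv_interval a b \<psi> x"
    if "\<phi> \<in> flat_functions a b" "\<psi> \<in> flat_functions a b" and x: "x \<in> {a..b}" for \<phi> \<psi> x
    using that
    by (intro deriv_interval_eqI[OF ab x] has_vector_derivative_transform[OF x restrict_apply']
        has_vector_derivative_add flat_functions_has_vector_derivative)
  have "compose (flat_functions a b) (op_deriv a b) (op_add a b S T) =
      op_add a b (compose (flat_functions a b) (op_deriv a b) S) (compose (flat_functions a b) (op_deriv a b) T)"
  proof (rule compose_op_add[OF ab add.hyps])
    fix \<phi> \<psi> assume "\<phi> \<in> flat_functions a b" "\<psi> \<in> flat_functions a b"
    then show "op_deriv a b (\<lambda>x\<in>{a..b}. \<phi> x + \<psi> x) = (\<lambda>x\<in>{a..b}. op_deriv a b \<phi> x + op_deriv a b \<psi> x)"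
      by (intro extensionalityI[of _ "{a..b}"])
        (simp_all add: op_deriv_def flat_functions_add[OF ab] d, simp add: deriv_interval_def)
  qed
  then show ?case using add.IH by (simp add: normal_ops.add)
qed

text \<open>Integration by parts removes one derivative at a time. The boundary term at \<open>x\<close> is a differential
monomial with coefficient \<open>f (x, x)\<close>; the one at \<open>a\<close> vanishes because the function is flat there.\<close>

lemma normal_ops_volterra_deriv_iterated:
  assumes ab: "a < b" and "smooth_on_triangle a b f"
  shows "(\<lambda>\<phi>\<in>flat_functions a b. \<lambda>x\<in>{a..b}. integral {a..x} (\<lambda>z. f (x, z) * (deriv_interval a b ^^ i) \<phi> z))
    \<in> normal_ops a b" (is "?W f i \<in> _")
  using assms(2)
proof (induction i arbitrary: f)
  case 0
  then have "op_volterra a b f \<in> normal_ops a b" by (rule normal_ops.volterra)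
  then show ?case by (simp only: op_volterra_def funpow_0)
next
  case (Suc i)
  obtain fx fy where f: "has_triangle_partials a b f fx fy" "smooth_on_triangle a b fy"
    using Suc.prems by (rule smooth_on_triangle_partials)
  have parts: "integral {a..x} (\<lambda>z. f (x, z) * deriv_interval a b \<psi> z) =
      f (x, x) * \<psi> x + integral {a..x} (\<lambda>z. (- 1 * fy (x, z)) * \<psi> z)"
    if \<psi>: "\<psi> \<in> flat_functions a b" and x: "x \<in> {a..b}" for \<psi> x
  proof -
    have "((\<lambda>z. f (x, z) * deriv_interval a b \<psi> z + fy (x, z) * \<psi> z) has_integral
        f (x, x) * \<psi> x - f (x, a) * \<psi> a) {a..x}"
    proof (rule fundamental_theorem_of_calculus)
      fix z assume z: "z \<in> {a..x}"
      have "((\<lambda>t. f (x, t)) has_vector_derivative fy (x, z)) (at z within {a..x})"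
        using z x by (intro has_triangle_partialsD(3)[OF f(1)]) (simp add: triangle_iff)
      moreover have "(\<psi> has_vector_derivative deriv_interval a b \<psi> z) (at z within {a..x})"
        using z x by (intro has_vector_derivative_within_subset[OF flat_functions_has_vector_derivative[OF \<psi>]]) auto
      ultimately show "((\<lambda>z. f (x, z) * \<psi> z) has_vector_derivative
          f (x, z) * deriv_interval a b \<psi> z + fy (x, z) * \<psi> z) (at z within {a..x})"
        by (rule has_vector_derivative_mult)
    qed (use x in auto)
    from integral_unique[OF this]
    have "integral {a..x} (\<lambda>z. f (x, z) * deriv_interval a b \<psi> z + fy (x, z) * \<psi> z) = f (x, x) * \<psi> x"
      using flat_functions_zero[OF \<psi>] by simp
    moreover have "integral {a..x} (\<lambda>z. f (x, z) * deriv_interval a b \<psi> z + fy (x, z) * \<psi> z) =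
        integral {a..x} (\<lambda>z. f (x, z) * deriv_interval a b \<psi> z) + integral {a..x} (\<lambda>z. fy (x, z) * \<psi> z)"
      by (intro integral_add integrable_continuous_real volterra_continuous[OF _ _ x] smooth_on_triangle_continuous
          flat_functions_continuous flat_functions_deriv \<psi> f Suc.prems x)
    ultimately show ?thesis by (simp add: algebra_simps)
  qed
  have eq: "?W f (Suc i) = op_add a b (op_monomial a b (\<lambda>x\<in>{a..b}. f (x, x)) i) (?W (\<lambda>p. - 1 * fy p) i)"
    using parts[OF flat_functions_deriv_iterated, of _ _ i]
    by (intro operator_eqI[of _ a b]) (simp_all add: op_add_def op_monomial_def restrict_apply' del: restrict_apply)
  show ?case
    unfolding eq
    by (rule normal_ops.add[OF normal_ops.monomial[OF smooth_interval_diagonal[OF ab Suc.prems]]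
          Suc.IH[OF smooth_on_triangle_mult[OF ab smooth_on_triangle_const f(2)]]])
qed

text \<open>Interchanging the integrations shows that the composition of two Volterra operators has as kernel the
convolution of their kernels.\<close>

lemma volterra_compose:
  assumes ab: "a < b" and f: "smooth_on_triangle a b f" and g: "smooth_on_triangle a b g"
    and \<phi>: "continuous_on {a..b} \<phi>" and x: "x \<in> {a..b}"
  shows "integral {a..x} (\<lambda>z. f (x, z) * integral {a..z} (\<lambda>y. g (z, y) * \<phi> y)) =
    integral {a..x} (\<lambda>y. integral {y..x} (\<lambda>z. f (x, z) * g (z, y)) * \<phi> y)"
proof -
  have "continuous_on (triangle a x) (\<lambda>p. f (x, fst p) * g p * \<phi> (snd p))"
    using x by (auto simp: triangle_def intro!: continuous_intros
        continuous_on_compose2[OF smooth_on_triangle_continuous[OF f]]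
        continuous_on_subset[OF smooth_on_triangle_continuous[OF g]] continuous_on_compose2[OF \<phi>])
  then have "integral {a..x} (\<lambda>z. integral {a..z} (\<lambda>y. f (x, z) * g (z, y) * \<phi> y)) =
      integral {a..x} (\<lambda>y. integral {y..x} (\<lambda>z. f (x, z) * g (z, y) * \<phi> y))"
    using triangle_integral_swap[of a x "\<lambda>p. f (x, fst p) * g p * \<phi> (snd p)" x] x by simp
  moreover have "f (x, z) * integral {a..z} (\<lambda>y. g (z, y) * \<phi> y) =
      integral {a..z} (\<lambda>y. f (x, z) * g (z, y) * \<phi> y)" for z
    by (simp add: mult.assoc)
  ultimately show ?thesis by simp
qed

lemma normal_ops_volterra:
  assumes ab: "a < b" and f: "smooth_on_triangle a b f" and "T \<in> normal_ops a b"
  shows "compose (flat_functions a b) (op_volterra a b f) T \<in> normal_ops a b"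
  using assms(3)
proof induction
  case (monomial P i)
  have "integral {a..x} (\<lambda>z. f (x, z) * restrict (\<lambda>x. P x * \<psi> x) {a..b} z) =
      integral {a..x} (\<lambda>z. f (x, z) * P (snd (x, z)) * \<psi> z)" if "x \<in> {a..b}" for \<psi> x
    using that by (intro integral_cong) auto
  then have eq: "compose (flat_functions a b) (op_volterra a b f) (op_monomial a b P i) =
      (\<lambda>\<phi>\<in>flat_functions a b. \<lambda>x\<in>{a..b}.
        integral {a..x} (\<lambda>z. (\<lambda>p. f p * P (snd p)) (x, z) * (deriv_interval a b ^^ i) \<phi> z))"
    using normal_ops_flat[OF ab normal_ops.monomial[OF monomial]]
    by (intro operator_eqI[of _ a b]) (simp_all add: compose_def op_volterra_def op_monomial_def)
  show ?case
    unfolding eq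
    by (rule normal_ops_volterra_deriv_iterated[OF ab smooth_on_triangle_mult[OF ab f smooth_on_triangle_snd[OF ab monomial]]])
next
  case (volterra g)
  have "integral {a..x} (\<lambda>z. f (x, z) * restrict (\<lambda>z. integral {a..z} (\<lambda>y. g (z, y) * \<phi> y)) {a..b} z) =
      integral {a..x} (\<lambda>y. (\<lambda>(x, y). integral {y..x} (\<lambda>z. f (x, z) * g (z, y))) (x, y) * \<phi> y)"
    if \<phi>: "\<phi> \<in> flat_functions a b" and x: "x \<in> {a..b}" for \<phi> x
  proof -
    have "integral {a..x} (\<lambda>z. f (x, z) * restrict (\<lambda>z. integral {a..z} (\<lambda>y. g (z, y) * \<phi> y)) {a..b} z) =
        integral {a..x} (\<lambda>z. f (x, z) * integral {a..z} (\<lambda>y. g (z, y) * \<phi> y))"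
      using x by (intro integral_cong) auto
    then show ?thesis
      using volterra_compose[OF ab f volterra flat_functions_continuous[OF \<phi>] x] by simp
  qed
  then have "compose (flat_functions a b) (op_volterra a b f) (op_volterra a b g) =
      op_volterra a b (\<lambda>(x, y). integral {y..x} (\<lambda>z. f (x, z) * g (z, y)))"
    using normal_ops_flat[OF ab normal_ops.volterra[OF volterra]]
    by (intro operator_eqI[of _ a b]) (simp_all add: compose_def op_volterra_def)
  then show ?case using normal_ops.volterra[OF smooth_on_triangle_conv[OF ab f volterra]] by simp
next
  case (add S T)
  have "compose (flat_functions a b) (op_volterra a b f) (op_add a b S T) =
      op_add a b (compose (flat_functions a b) (op_volterra a b f) S) (compose (flat_functions a b) (op_volterra a b f) T)"
  proof (rule compose_op_add[OF ab add.hyps])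
    fix \<phi> \<psi> assume \<phi>: "\<phi> \<in> flat_functions a b" and \<psi>: "\<psi> \<in> flat_functions a b"
    have "integral {a..x} (\<lambda>z. f (x, z) * restrict (\<lambda>x. \<phi> x + \<psi> x) {a..b} z) =
        integral {a..x} (\<lambda>z. f (x, z) * \<phi> z) + integral {a..x} (\<lambda>z. f (x, z) * \<psi> z)"
      if x: "x \<in> {a..b}" for x
    proof -
      have "integral {a..x} (\<lambda>z. f (x, z) * restrict (\<lambda>x. \<phi> x + \<psi> x) {a..b} z) =
          integral {a..x} (\<lambda>z. f (x, z) * \<phi> z + f (x, z) * \<psi> z)"
        using x by (intro integral_cong) (auto simp: algebra_simps)
      also have "\<dots> = integral {a..x} (\<lambda>z. f (x, z) * \<phi> z) + integral {a..x} (\<lambda>z. f (x, z) * \<psi> z)"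
        by (intro integral_add integrable_continuous_real volterra_continuous[OF _ _ x] smooth_on_triangle_continuous
            flat_functions_continuous \<phi> \<psi> f x)
      finally show ?thesis .
    qed
    then show "op_volterra a b f (\<lambda>x\<in>{a..b}. \<phi> x + \<psi> x) = (\<lambda>x\<in>{a..b}. op_volterra a b f \<phi> x + op_volterra a b f \<psi> x)"
      by (intro extensionalityI[of _ "{a..b}"]) (simp_all add: op_volterra_def \<phi> \<psi> flat_functions_add[OF ab])
  qed
  then show ?case using add.IH by (simp add: normal_ops.add)
qed

text \<open>Putting the element of the algebra on the left of an arbitrary operator in normal form makes the
composition step of the induction mere associativity; only the generators need work.\<close>

lemma compose_I_M_normal_ops:
  assumes ab: "a < b" and "S \<in> I_M a b" and "T \<in> normal_ops a b"
  shows "compose (flat_functions a b) S T \<in> normal_ops a b"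
  using assms(2,3)
proof (induction arbitrary: T)
  case (mult P)
  then show ?case by (rule normal_ops_mult[OF ab])
next
  case deriv
  then show ?case by (rule normal_ops_deriv[OF ab])
next
  case (volterra f)
  then show ?case by (intro normal_ops_volterra[OF ab]) (auto simp: smooth_triangle_def)
next
  case (add S1 S2)
  have "compose (flat_functions a b) (op_add a b S1 S2) T =
      op_add a b (compose (flat_functions a b) S1 T) (compose (flat_functions a b) S2 T)"
    using normal_ops_flat[OF ab add.prems]
    by (intro extensionalityI[of _ "flat_functions a b"]) (simp_all add: compose_def op_add_def)
  then show ?case using add.IH[OF add.prems] by (simp add: normal_ops.add)
next
  case (scale S c)
  have "compose (flat_functions a b) (op_scale a b c S) T =
      compose (flat_functions a b) (op_mult a b (\<lambda>x\<in>{a..b}. c)) (compose (flat_functions a b) S T)"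
    using normal_ops_flat[OF ab scale.prems] normal_ops_flat[OF ab scale.IH[OF scale.prems]]
    by (intro extensionalityI[of _ "flat_functions a b"])
      (auto simp: compose_def op_scale_def op_mult_def intro!: restrict_ext)
  then show ?case
    using normal_ops_mult[OF ab smooth_interval_const[OF ab] scale.IH[OF scale.prems]] by simp
next
  case (comp S1 S2)
  have "compose (flat_functions a b) (compose (flat_functions a b) S1 S2) T =
      compose (flat_functions a b) S1 (compose (flat_functions a b) S2 T)"
    using normal_ops_flat[OF ab comp.prems]
    by (intro extensionalityI[of _ "flat_functions a b"]) (simp_all add: compose_def)
  then show ?case using comp.IH comp.prems by simp
qed

lemma I_M_subset_normal_ops:
  assumes ab: "a < b" and S: "S \<in> I_M a b"
  shows "S \<in> normal_ops a b"
proof -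
  let ?id = "op_monomial a b (\<lambda>x\<in>{a..b}. 1) 0"
  have "?id \<phi> = \<phi>" if "\<phi> \<in> flat_functions a b" for \<phi>
    using that flat_functions_extensional[OF that]
    by (intro extensionalityI[of _ "{a..b}"]) (simp_all add: op_monomial_def)
  moreover have "S \<in> extensional (flat_functions a b)"
    using S by cases auto
  ultimately have "compose (flat_functions a b) S ?id = S"
    by (intro extensionalityI[of _ "flat_functions a b"]) (simp_all add: compose_def)
  then show ?thesis
    using compose_I_M_normal_ops[OF ab S normal_ops.monomial[OF smooth_interval_const[OF ab]], of 1 0] by simp
qed

section \<open>Reading off the normal form\<close>

lemma op_deriv_iterated:
  "\<phi> \<in> flat_functions a b \<Longrightarrow> (op_deriv a b ^^ i) \<phi> = (deriv_interval a b ^^ i) \<phi>"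
  by (induction i) (simp_all add: op_deriv_def flat_functions_deriv_iterated)

lemma normal_form_apply:
  assumes "\<phi> \<in> flat_functions a b" "x \<in> {a..b}"
  shows "normal_form a b n P f \<phi> x =
    (\<Sum>i\<le>n. P i x * (deriv_interval a b ^^ i) \<phi> x) + integral {a..x} (\<lambda>z. f (x, z) * \<phi> z)"
proof -
  have "{..n} = insert 0 {1..n}" by auto
  then show ?thesis
    using assms by (simp add: normal_form_def op_deriv_iterated op_mult_def op_volterra_def
        flat_functions_deriv_iterated)
qed

lemma sum_atMost_pad:
  fixes p d :: "nat \<Rightarrow> complex"
  assumes "n \<le> N"
  shows "(\<Sum>i\<le>n. p i * d i) = (\<Sum>i\<le>N. (if i \<le> n then p i else 0) * d i)"
  by (rule sum.mono_neutral_cong_left) (use assms in auto)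

text \<open>In a sum the two differential parts may have different orders; the shorter one is padded with zero
coefficients.\<close>

lemma normal_ops_normal_form:
  assumes ab: "a < b" and "T \<in> normal_ops a b"
  shows "\<exists>n P f. (\<forall>i\<le>n. P i \<in> smooth_interval a b) \<and> f \<in> smooth_triangle a b \<and> T = normal_form a b n P f"
  using assms(2)
proof induction
  case (monomial P i)
  let ?P = "\<lambda>j. if j = i then P else (\<lambda>x\<in>{a..b}. 0)"
  let ?f = "restrict (\<lambda>_. 0) (triangle a b)"
  have zero: "integral {a..x} (\<lambda>z. ?f (x, z) * \<phi> z) = integral {a..x} (\<lambda>z. 0)" if "x \<in> {a..b}" for x and \<phi> :: "real \<Rightarrow> complex"
    using that by (intro integral_cong) (simp add: triangle_iff)
  have "op_monomial a b P i = normal_form a b i ?P ?f"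
  proof (intro operator_eqI[of _ a b])
    fix \<phi> x assume "\<phi> \<in> flat_functions a b" and x: "x \<in> {a..b}"
    moreover have "(\<Sum>j\<le>i. ?P j x * (deriv_interval a b ^^ j) \<phi> x) =
        (\<Sum>j\<le>i. if j = i then P x * (deriv_interval a b ^^ i) \<phi> x else 0)"
      using x by (intro sum.cong) auto
    ultimately show "op_monomial a b P i \<phi> x = normal_form a b i ?P ?f \<phi> x"
      using zero[OF x] by (simp only: normal_form_apply) (simp add: op_monomial_def)
  qed (simp_all add: op_monomial_def normal_form_def)
  moreover have "\<forall>j\<le>i. ?P j \<in> smooth_interval a b" using monomial smooth_interval_const[OF ab] by simp
  moreover have "?f \<in> smooth_triangle a b" by (rule restrict_smooth_triangle[OF smooth_on_triangle_const])
  ultimately show ?case by (intro exI[of _ i] exI[of _ ?P] exI[of _ ?f] conjI)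
next
  case (volterra f)
  let ?f = "restrict f (triangle a b)"
  have "integral {a..x} (\<lambda>z. ?f (x, z) * \<phi> z) = integral {a..x} (\<lambda>z. f (x, z) * \<phi> z)" if "x \<in> {a..b}" for x and \<phi> :: "real \<Rightarrow> complex"
    using that by (intro integral_cong) (simp add: triangle_iff)
  then have "op_volterra a b f = normal_form a b 0 (\<lambda>_. \<lambda>x\<in>{a..b}. 0) ?f"
    by (intro operator_eqI[of _ a b]) (simp_all add: normal_form_apply op_volterra_def, simp_all add: normal_form_def)
  then show ?case
    using restrict_smooth_triangle[OF volterra]
    by (intro exI[of _ 0] exI[of _ "\<lambda>_. \<lambda>x\<in>{a..b}. 0"] exI[of _ ?f] conjI allI impI
        smooth_interval_const[OF ab])
next
  case (add S T)
  then obtain n P f m Q g where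
    S: "\<forall>i\<le>n. P i \<in> smooth_interval a b" "f \<in> smooth_triangle a b" "S = normal_form a b n P f" and
    T: "\<forall>i\<le>m. Q i \<in> smooth_interval a b" "g \<in> smooth_triangle a b" "T = normal_form a b m Q g"
    by blast
  let ?N = "max n m"
  let ?P = "\<lambda>i. if i \<le> n then P i else (\<lambda>x\<in>{a..b}. 0)"
  let ?Q = "\<lambda>i. if i \<le> m then Q i else (\<lambda>x\<in>{a..b}. 0)"
  let ?R = "\<lambda>i. \<lambda>x\<in>{a..b}. ?P i x + ?Q i x"
  let ?h = "restrict (\<lambda>p. f p + g p) (triangle a b)"
  have fg: "smooth_on_triangle a b f" "smooth_on_triangle a b g"
    using S(2) T(2) by (auto simp: smooth_triangle_def)
  have int: "integral {a..x} (\<lambda>z. ?h (x, z) * \<phi> z) =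
      integral {a..x} (\<lambda>z. f (x, z) * \<phi> z) + integral {a..x} (\<lambda>z. g (x, z) * \<phi> z)"
    if \<phi>: "\<phi> \<in> flat_functions a b" and x: "x \<in> {a..b}" for \<phi> x
  proof -
    have "integral {a..x} (\<lambda>z. ?h (x, z) * \<phi> z) = integral {a..x} (\<lambda>z. f (x, z) * \<phi> z + g (x, z) * \<phi> z)"
      using x by (intro integral_cong) (simp add: triangle_iff algebra_simps)
    also have "\<dots> = integral {a..x} (\<lambda>z. f (x, z) * \<phi> z) + integral {a..x} (\<lambda>z. g (x, z) * \<phi> z)"
      by (intro integral_add integrable_continuous_real volterra_continuous[OF _ _ x] smooth_on_triangle_continuous
            flat_functions_continuous \<phi> fg x)
    finally show ?thesis .
  qed
  have sum: "(\<Sum>i\<le>?N. ?R i x * d i) = (\<Sum>i\<le>n. P i x * d i) + (\<Sum>i\<le>m. Q i x * d i)"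
    if x: "x \<in> {a..b}" for x and d :: "nat \<Rightarrow> complex"
    unfolding sum_atMost_pad[of n ?N "\<lambda>i. P i x" d, OF max.cobounded1]
      sum_atMost_pad[of m ?N "\<lambda>i. Q i x" d, OF max.cobounded2] sum.distrib[symmetric]
    using x by (intro sum.cong) (auto simp: algebra_simps)
  have "op_add a b S T = normal_form a b ?N ?R ?h"
  proof (rule operator_eqI[of _ a b])
    fix \<phi> x assume "\<phi> \<in> flat_functions a b" and "x \<in> {a..b}"
    then show "op_add a b S T \<phi> x = normal_form a b ?N ?R ?h \<phi> x"
      unfolding normal_form_apply[OF \<open>\<phi> \<in> _\<close> \<open>x \<in> _\<close>] sum[OF \<open>x \<in> _\<close>] int[OF \<open>\<phi> \<in> _\<close> \<open>x \<in> _\<close>]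
      by (simp add: op_add_def S(3) T(3) normal_form_apply)
  qed (simp_all add: op_add_def normal_form_def)
  moreover have "\<forall>i\<le>?N. ?R i \<in> smooth_interval a b"
    using S(1) T(1) smooth_interval_const[OF ab] by (intro allI impI smooth_interval_add[OF ab]) auto
  moreover have "?h \<in> smooth_triangle a b"
    by (intro restrict_smooth_triangle smooth_on_triangle_add fg)
  ultimately show ?case by (intro exI[of _ ?N] exI[of _ ?R] exI[of _ ?h] conjI)
qed

section \<open>Bump functions\<close>

text \<open>The functions \<open>p(1/t) e\<^bsup>-1/t\<^esup>\<close>, extended by zero to \<open>t \<le> 0\<close>. With all polynomials \<open>p\<close> admitted
they are closed under differentiation.\<close>

definition exp_cutoff :: "real poly \<Rightarrow> real \<Rightarrow> real" where
  "exp_cutoff p t = (if t > 0 then poly p (inverse t) * exp (- inverse t) else 0)"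

lemma poly_times_exp_minus_tendsto_0:
  fixes p :: "real poly"
  shows "((\<lambda>u. u ^ k * poly p u * exp (- u)) \<longlongrightarrow> 0) at_top"
proof (induction p arbitrary: k)
  case (pCons c p)
  have "((\<lambda>u. c * (u ^ k / exp u) + u ^ Suc k * poly p u * exp (- u)) \<longlongrightarrow> c * 0 + 0) at_top"
    by (intro tendsto_add tendsto_mult tendsto_const tendsto_power_div_exp_0 pCons.IH)
  then show ?case by (simp add: exp_minus field_simps)
qed simp

text \<open>For \<open>t > 0\<close> the substitution \<open>u = 1/t\<close>, with \<open>du/dt = - u\<^sup>2\<close>, gives \<open>p(u) e\<^bsup>-u\<^esup>\<close> the derivative \<open>u\<^sup>2 (p - p') e\<^bsup>-u\<^esup>\<close>. At
\<open>0\<close> the difference quotient tends to \<open>0\<close> because \<open>e\<^bsup>-u\<^esup>\<close> beats every polynomial.\<close>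

lemma exp_cutoff_DERIV:
  "(exp_cutoff p has_real_derivative exp_cutoff ([:0, 0, 1:] * (p - pderiv p)) t) (at t)"
proof -
  consider "t < 0" | "t > 0" | "t = 0" by linarith
  then show ?thesis
  proof cases
    case 1
    have "((\<lambda>_. 0) has_real_derivative 0) (at t)" by simp
    then have "(exp_cutoff p has_real_derivative 0) (at t)"
      by (rule has_field_derivative_transform_within_open[of _ _ _ "{..<0}"])
        (use 1 in \<open>auto simp: exp_cutoff_def\<close>)
    then show ?thesis using 1 by (simp add: exp_cutoff_def)
  next
    case 2
    have "((\<lambda>s. poly p (inverse s) * exp (- inverse s)) has_real_derivative
        exp_cutoff ([:0, 0, 1:] * (p - pderiv p)) t) (at t)"
      using 2 by (auto intro!: derivative_eq_intros DERIV_chain2[OF poly_DERIV]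
          simp: exp_cutoff_def power2_eq_square algebra_simps)
    then show ?thesis
      by (rule has_field_derivative_transform_within_open[of _ _ _ "{0<..}"])
        (use 2 in \<open>auto simp: exp_cutoff_def\<close>)
  next
    case 3
    have "((\<lambda>y. exp_cutoff p y / y) \<longlongrightarrow> 0) (at 0)"
    proof (rule filterlim_split_at)
      have "\<forall>\<^sub>F y in at_left (0::real). exp_cutoff p y / y = 0"
        by (auto simp: eventually_at_filter exp_cutoff_def)
      then show "((\<lambda>y. exp_cutoff p y / y) \<longlongrightarrow> 0) (at_left 0)"
        by (rule tendsto_eventually)
      have "\<forall>\<^sub>F u in at_top. u ^ 1 * poly p u * exp (- u) = exp_cutoff p (inverse u) / inverse u"
        using eventually_gt_at_top[of "0::real"] by eventually_elim (simp add: exp_cutoff_def field_simps)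
      then show "((\<lambda>y. exp_cutoff p y / y) \<longlongrightarrow> 0) (at_right 0)"
        unfolding filterlim_at_right_to_top
        by (rule Lim_transform_eventually[OF poly_times_exp_minus_tendsto_0])
    qed
    then show ?thesis using 3 by (simp add: has_field_derivative_iff exp_cutoff_def)
  qed
qed

lemma exp_cutoff_flat:
  assumes "a < b" "a \<le> c"
  shows "(\<lambda>t\<in>{a..b}. complex_of_real (exp_cutoff p (t - c))) \<in> flat_functions a b"
proof (rule flat_functions_closed_class[OF assms(1), where C = "range (\<lambda>p t. complex_of_real (exp_cutoff p (t - c)))"])
  fix F assume "F \<in> range (\<lambda>p t. complex_of_real (exp_cutoff p (t - c)))"
  then obtain q where F: "F = (\<lambda>t. complex_of_real (exp_cutoff q (t - c)))" by auto
  show "F a = 0" using assms(2) by (simp add: F exp_cutoff_def)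
  have "((\<lambda>t. exp_cutoff q (t - c)) has_real_derivative exp_cutoff ([:0, 0, 1:] * (q - pderiv q)) (x - c) * 1)
      (at x)" for x
    by (rule DERIV_chain2[OF exp_cutoff_DERIV]) (auto intro!: derivative_eq_intros)
  from has_vector_derivative_of_real[OF has_field_derivative_at_within[OF this]]
  have "(F has_vector_derivative complex_of_real (exp_cutoff ([:0, 0, 1:] * (q - pderiv q)) (x - c)))
      (at x within {a..b})" for x
    unfolding F by (simp only: mult_1_right)
  then show "\<exists>G\<in>range (\<lambda>p t. complex_of_real (exp_cutoff p (t - c))).
      \<forall>x\<in>{a..b}. (F has_vector_derivative G x) (at x within {a..b})"
    by (intro bexI[OF _ rangeI] ballI)
qed simp

lemma exp_cutoff_reflected_smooth:
  assumes "a < b"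
  shows "(\<lambda>t\<in>{a..b}. complex_of_real (exp_cutoff p (d - t))) \<in> smooth_interval a b"
proof (rule smooth_interval_closed_class[OF assms(1), where C = "range (\<lambda>p t. complex_of_real (exp_cutoff p (d - t)))"])
  fix F assume "F \<in> range (\<lambda>p t. complex_of_real (exp_cutoff p (d - t)))"
  then obtain q where F: "F = (\<lambda>t. complex_of_real (exp_cutoff q (d - t)))" by auto
  have neg: "exp_cutoff (- r) t = - exp_cutoff r t" for r t by (simp add: exp_cutoff_def)
  have "((\<lambda>t. exp_cutoff q (d - t)) has_real_derivative exp_cutoff ([:0, 0, 1:] * (q - pderiv q)) (d - x) * (- 1))
      (at x)" for x
    by (rule DERIV_chain2[OF exp_cutoff_DERIV]) (auto intro!: derivative_eq_intros)
  from has_vector_derivative_of_real[OF has_field_derivative_at_within[OF this]]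
  have "(F has_vector_derivative complex_of_real (exp_cutoff (- ([:0, 0, 1:] * (q - pderiv q))) (d - x)))
      (at x within {a..b})" for x
    unfolding F neg by (simp only: mult_minus1_right)
  then show "\<exists>G\<in>range (\<lambda>p t. complex_of_real (exp_cutoff p (d - t))).
      \<forall>x\<in>{a..b}. (F has_vector_derivative G x) (at x within {a..b})"
    by (intro bexI[OF _ rangeI] ballI)
qed simp

definition bump :: "real \<Rightarrow> real \<Rightarrow> real \<Rightarrow> real" where
  "bump c d t = exp_cutoff 1 (t - c) * exp_cutoff 1 (d - t)"

lemma bump_nonneg: "bump c d t \<ge> 0"
  by (simp add: bump_def exp_cutoff_def)

lemma bump_pos: "c < t \<Longrightarrow> t < d \<Longrightarrow> bump c d t > 0"
  by (simp add: bump_def exp_cutoff_def)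

lemma bump_eq_0: "t \<le> c \<or> d \<le> t \<Longrightarrow> bump c d t = 0"
  by (auto simp: bump_def exp_cutoff_def)

lemma bump_continuous: "continuous_on S (bump c d)"
proof -
  have "continuous_on UNIV (exp_cutoff 1)"
    by (intro continuous_at_imp_continuous_on ballI DERIV_isCont[OF exp_cutoff_DERIV])
  note compose = continuous_on_compose2[OF this _ subset_UNIV]
  have "continuous_on S (\<lambda>t. exp_cutoff 1 (t - c))" "continuous_on S (\<lambda>t. exp_cutoff 1 (d - t))"
    by (rule compose, intro continuous_intros)+
  then show ?thesis
    unfolding bump_def by (rule continuous_on_mult)
qed

lemma bump_flat:
  assumes "a < b" "a \<le> c"
  shows "(\<lambda>t\<in>{a..b}. complex_of_real (bump c d t)) \<in> flat_functions a b"
proof -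
  have "(\<lambda>t\<in>{a..b}. complex_of_real (bump c d t)) =
      (\<lambda>x\<in>{a..b}. (\<lambda>t\<in>{a..b}. complex_of_real (exp_cutoff 1 (d - t))) x *
        (\<lambda>t\<in>{a..b}. complex_of_real (exp_cutoff 1 (t - c))) x)"
    by (auto simp: bump_def)
  then show ?thesis
    using flat_functions_mult[OF assms(1) exp_cutoff_reflected_smooth[OF assms(1)] exp_cutoff_flat[OF assms]]
    by (simp only:)
qed

lemma deriv_interval_iterated_locally_zero:
  assumes ab: "a < b" and \<phi>: "\<And>x. x \<in> {a..b} \<Longrightarrow> d < x \<Longrightarrow> \<phi> x = 0"
    and x: "x \<in> {a..b}" "d < x"
  shows "(deriv_interval a b ^^ i) \<phi> x = 0"
  using x
proof (induction i arbitrary: x)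
  case 0
  then show ?case using \<phi> by simp
next
  case (Suc i)
  have "((\<lambda>_. 0) has_vector_derivative 0) (at x within {a..b})" by simp
  then have "((deriv_interval a b ^^ i) \<phi> has_vector_derivative 0) (at x within {a..b})"
    by (rule has_vector_derivative_transform_within[of _ _ _ _ "x - d"])
      (use Suc in \<open>auto simp: dist_real_def\<close>)
  then show ?case using deriv_interval_eqI[OF ab Suc.prems(1)] by simp
qed

section \<open>Uniqueness of the coefficients and the kernel\<close>

text \<open>The fundamental lemma of the calculus of variations: where \<open>u y \<noteq> 0\<close>, the real part of \<open>cnj (u y) * u\<close>
is positive near \<open>y\<close>, so its integral against a bump concentrated there is positive.\<close>

lemma integral_against_bumps_zero:
  fixes u :: "real \<Rightarrow> complex"
  assumes u: "continuous_on {a..x} u"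
    and zero: "\<And>c d. a \<le> c \<Longrightarrow> d < x \<Longrightarrow> integral {a..x} (\<lambda>z. u z * complex_of_real (bump c d z)) = 0"
    and y: "a < y" "y < x"
  shows "u y = 0"
proof (rule ccontr)
  assume ne: "u y \<noteq> 0"
  have ax: "a < x" using y by simp
  define r where "r z = Re (cnj (u y) * u z)" for z
  have ry: "r y > 0"
  proof -
    have "r y = (cmod (u y))\<^sup>2" by (simp add: r_def cmod_power2) (simp add: power2_eq_square)
    then show ?thesis using ne by simp
  qed
  have rc: "continuous_on {a..x} r"
    unfolding r_def by (intro continuous_intros u)
  have "continuous_on {a<..<x} r" by (rule continuous_on_subset[OF rc]) auto
  then have "open ({a<..<x} \<inter> r -` {0<..})"
    by (rule continuous_open_preimage) auto
  moreover have "y \<in> {a<..<x} \<inter> r -` {0<..}" using y ry by simp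
  ultimately obtain e where e: "e > 0" "ball y e \<subseteq> {a<..<x} \<inter> r -` {0<..}"
    by (meson open_contains_ball)
  \<comment> \<open>Half the radius keeps the closed interval \<open>[c,d]\<close> inside the ball.\<close>
  define c d where "c = y - e / 2" and "d = y + e / 2"
  have cd: "{c..d} \<subseteq> {a<..<x} \<inter> r -` {0<..}"
    by (rule subset_trans[OF _ e(2)]) (use e(1) in \<open>auto simp: c_def d_def dist_real_def abs_if\<close>)
  have cyd: "c < y" "y < d" using e(1) by (auto simp: c_def d_def)
  have acdx: "a < c" "d < x" using cd cyd by (auto simp: subset_iff)
  have bc: "continuous_on {a..x} (bump c d)"
    by (rule bump_continuous)
  let ?v = "\<lambda>z. cnj (u y) * (u z * complex_of_real (bump c d z))"
  have int: "?v integrable_on {a..x}"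
    by (intro integrable_continuous_real continuous_intros u bc)
  have "integral {a..x} (\<lambda>z. u z * complex_of_real (bump c d z)) = 0" using zero[of c d] acdx by simp
  moreover have "integral {a..x} (\<lambda>z. Re (?v z)) = Re (integral {a..x} ?v)"
    using integral_linear[OF int bounded_linear_Re] by (simp add: o_def)
  moreover have "Re (?v z) = r z * bump c d z" for z
    by (simp add: r_def algebra_simps)
  ultimately have "integral {a..x} (\<lambda>z. r z * bump c d z) = 0" by simp
  moreover have "continuous_on {a..x} (\<lambda>z. r z * bump c d z)"
    by (intro continuous_intros rc bc)
  moreover have "r z * bump c d z \<ge> 0" for z
  proof (cases "c < z \<and> z < d")
    case True
    then have "z \<in> {c..d}" by simp
    then have "r z > 0" using cd by blast
    then show ?thesis using bump_nonneg[of c d z] by simp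
  next
    case False
    then have "bump c d z = 0" by (intro bump_eq_0) auto
    then show ?thesis by simp
  qed
  ultimately have "\<forall>z\<in>{a..x}. r z * bump c d z = 0"
    using integral_eq_0_iff[of a x "\<lambda>z. r z * bump c d z"] ax by blast
  then have "r y * bump c d y = 0" using y by simp
  then show False using ry bump_pos[OF cyd] by simp
qed

text \<open>The commutation rule between \<open>\<partial>\<^sup>i\<close> and multiplication by \<open>t - c\<close>. For \<open>i = 0\<close> the exponent \<open>i - 1\<close> is \<open>0\<close>
and the term has the factor \<open>0\<close>.\<close>

lemma deriv_interval_iterated_shifted_mult:
  assumes ab: "a < b" and \<phi>: "\<phi> \<in> flat_functions a b" and x: "x \<in> {a..b}"
  shows "(deriv_interval a b ^^ i) (\<lambda>t\<in>{a..b}. complex_of_real (t - c) * \<phi> t) x =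
    complex_of_real (x - c) * (deriv_interval a b ^^ i) \<phi> x + of_nat i * (deriv_interval a b ^^ (i - 1)) \<phi> x"
  using x
proof (induction i arbitrary: x)
  case (Suc i)
  let ?D = "deriv_interval a b"
  have d: "((?D ^^ k) \<phi> has_vector_derivative (?D ^^ Suc k) \<phi> x) (at x within {a..b})" for k
    using flat_functions_has_vector_derivative[OF flat_functions_deriv_iterated[OF \<phi>] Suc.prems] by simp
  have "((\<lambda>x. of_nat i * (?D ^^ (i - 1)) \<phi> x) has_vector_derivative of_nat i * (?D ^^ i) \<phi> x) (at x within {a..b})"
  proof (cases i)
    case (Suc j)
    then show ?thesis using d[of j] by (auto intro!: derivative_eq_intros)
  qed simp
  moreover have "((\<lambda>x. complex_of_real (x - c)) has_vector_derivative 1) (at x within {a..b})"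
    by (rule has_vector_derivative_eq_rhs[OF has_vector_derivative_of_real[where D = 1]])
      (auto intro!: derivative_eq_intros)
  ultimately have "((\<lambda>x. complex_of_real (x - c) * (?D ^^ i) \<phi> x + of_nat i * (?D ^^ (i - 1)) \<phi> x)
      has_vector_derivative (complex_of_real (x - c) * (?D ^^ Suc i) \<phi> x + 1 * (?D ^^ i) \<phi> x) +
        of_nat i * (?D ^^ i) \<phi> x) (at x within {a..b})"
    using d by (intro has_vector_derivative_add has_vector_derivative_mult)
  then have "((?D ^^ i) (\<lambda>t\<in>{a..b}. complex_of_real (t - c) * \<phi> t)
      has_vector_derivative (complex_of_real (x - c) * (?D ^^ Suc i) \<phi> x + 1 * (?D ^^ i) \<phi> x) +
        of_nat i * (?D ^^ i) \<phi> x) (at x within {a..b})"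
    by (rule has_vector_derivative_transform[OF Suc.prems Suc.IH, rotated])
  from deriv_interval_eqI[OF ab Suc.prems this] show ?case
    by (simp only: funpow.simps o_apply diff_Suc_1 of_nat_Suc distrib_right mult_1_left add.assoc)
qed simp

text \<open>Applying the given relation to \<open>(t - x) \<phi>\<close> instead of \<open>\<phi>\<close> gives, by the commutation rule, a relation of lower
order with coefficients \<open>(j + 1) r (j + 1)\<close>, so all coefficients but \<open>r 0\<close> vanish by induction. A flat
function with nonzero value at \<open>x\<close>, which exists because \<open>x > a\<close>, disposes of \<open>r 0\<close>.\<close>

lemma jet_coefficients_zero:
  fixes r :: "nat \<Rightarrow> complex"
  assumes ab: "a < b" and x: "a < x" "x \<le> b"
    and zero: "\<And>\<phi>. \<phi> \<in> flat_functions a b \<Longrightarrow> (\<Sum>i\<le>n. r i * (deriv_interval a b ^^ i) \<phi> x) = 0"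
    and i: "i \<le> n"
  shows "r i = 0"
  using zero i
proof (induction n arbitrary: r i)
  case 0
  let ?e = "\<lambda>t\<in>{a..b}. complex_of_real (exp_cutoff 1 (t - a))"
  have "?e \<in> flat_functions a b" by (rule exp_cutoff_flat[OF ab order_refl])
  from 0(1)[OF this] have "r 0 * ?e x = 0" by simp
  then have "r 0 = 0" using x by (simp add: exp_cutoff_def)
  then show ?case using 0(2) by simp
next
  case (Suc n)
  have higher: "r (Suc j) = 0" if "j \<le> n" for j
  proof -
    have "of_nat (Suc j) * r (Suc j) = 0"
    proof (rule Suc.IH[of "\<lambda>j. of_nat (Suc j) * r (Suc j)", OF _ that])
      fix \<phi> assume \<phi>: "\<phi> \<in> flat_functions a b"
      have id: "(\<lambda>t\<in>{a..b}. complex_of_real (t - x)) \<in> smooth_interval a b"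
        by (rule smooth_interval_closed_class[OF ab, where C = "{\<lambda>t. complex_of_real (t - x), \<lambda>_. 1, \<lambda>_. 0}"])
          (auto intro!: derivative_eq_intros)
      have "(\<lambda>t\<in>{a..b}. complex_of_real (t - x) * \<phi> t) =
          (\<lambda>t\<in>{a..b}. (\<lambda>t\<in>{a..b}. complex_of_real (t - x)) t * \<phi> t)" by auto
      then have "(\<lambda>t\<in>{a..b}. complex_of_real (t - x) * \<phi> t) \<in> flat_functions a b"
        using flat_functions_mult[OF ab id \<phi>] by (simp only:)
      from Suc.prems(1)[OF this]
      moreover have "x \<in> {a..b}" using x by simp
      ultimately have "(\<Sum>i\<le>Suc n. r i * (of_nat i * (deriv_interval a b ^^ (i - 1)) \<phi> x)) = 0"
        by (simp only: deriv_interval_iterated_shifted_mult[OF ab \<phi>] diff_self of_real_0 mult_zero_left add_0_left)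
      then show "(\<Sum>j\<le>n. of_nat (Suc j) * r (Suc j) * (deriv_interval a b ^^ j) \<phi> x) = 0"
        by (simp add: sum.atMost_Suc_shift algebra_simps del: sum.atMost_Suc)
    qed
    then show ?thesis unfolding mult_eq_0_iff of_nat_eq_0_iff by simp
  qed
  let ?e = "\<lambda>t\<in>{a..b}. complex_of_real (exp_cutoff 1 (t - a))"
  have "?e \<in> flat_functions a b" by (rule exp_cutoff_flat[OF ab order_refl])
  from Suc.prems(1)[OF this] have "r 0 * ?e x = 0"
    using higher by (simp add: sum.atMost_Suc_shift del: sum.atMost_Suc restrict_apply funpow.simps)
  then have "r 0 = 0" using x by (simp add: exp_cutoff_def)
  then show ?case using higher Suc.prems(2) by (cases i) auto
qed

lemma continuous_zero_on_Icc:
  fixes u :: "real \<Rightarrow> complex"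
  assumes "continuous_on {a..b} u" "\<And>x. a < x \<Longrightarrow> x < b \<Longrightarrow> u x = 0" "a < b" "x \<in> {a..b}"
  shows "u x = 0"
  by (rule continuous_constant_on_closure[where f = u and S = "{a<..<b}"])
    (use assms in \<open>simp_all add: closure_greaterThanLessThan\<close>)

text \<open>A bump supported to the left of \<open>x\<close> has zero jet at \<open>x\<close>, hence the differential part does not see
it, and the kernel vanishes on the section through \<open>x\<close>. What remains is a relation between jets at
\<open>x\<close>. Boundary values, in particular those at \<open>x = a\<close> where all jets are zero, follow by continuity.\<close>

lemma normal_form_coefficients_zero:
  assumes ab: "a < b"
    and R: "\<And>i. i \<le> n \<Longrightarrow> continuous_on {a..b} (R i)"
    and h: "continuous_on (triangle a b) h"
    and zero: "\<And>\<phi> x. \<phi> \<in> flat_functions a b \<Longrightarrow> x \<in> {a..b} \<Longrightarrow>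
      (\<Sum>i\<le>n. R i x * (deriv_interval a b ^^ i) \<phi> x) + integral {a..x} (\<lambda>z. h (x, z) * \<phi> z) = 0"
  shows "\<And>p. p \<in> triangle a b \<Longrightarrow> h p = 0"
    and "\<And>i x. i \<le> n \<Longrightarrow> x \<in> {a..b} \<Longrightarrow> R i x = 0"
proof -
  have row: "h (x, y) = 0" if x: "a < x" "x \<le> b" and y: "y \<in> {a..x}" for x y
  proof (rule continuous_zero_on_Icc[where u = "\<lambda>z. h (x, z)", OF _ _ x(1) y])
    show hc: "continuous_on {a..x} (\<lambda>z. h (x, z))"
      by (rule continuous_on_triangle_section[OF h]) (use x in auto)
    fix y assume y: "a < y" "y < x"
    show "h (x, y) = 0"
    proof (rule integral_against_bumps_zero[OF hc _ y])
      fix c d assume c: "a \<le> c" and d: "d < x"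
      let ?\<beta> = "\<lambda>t\<in>{a..b}. complex_of_real (bump c d t)"
      have "(deriv_interval a b ^^ i) ?\<beta> x = 0" for i
        by (rule deriv_interval_iterated_locally_zero[OF ab, of d]) (use x d in \<open>auto simp: bump_eq_0\<close>)
      then have "integral {a..x} (\<lambda>z. h (x, z) * ?\<beta> z) = 0"
        using zero[OF bump_flat[OF ab c], of x d] x by simp
      moreover have "integral {a..x} (\<lambda>z. h (x, z) * ?\<beta> z) =
          integral {a..x} (\<lambda>z. h (x, z) * complex_of_real (bump c d z))"
        by (rule integral_cong) (use x in auto)
      ultimately show "integral {a..x} (\<lambda>z. h (x, z) * complex_of_real (bump c d z)) = 0" by simp
    qed
  qed
  have corner: "h (a, a) = 0"
  proof (rule continuous_zero_on_Icc[where u = "\<lambda>x. h (x, a)", OF _ _ ab])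
    show "continuous_on {a..b} (\<lambda>x. h (x, a))"
      by (rule continuous_on_compose2[OF h _ image_subsetI])
        (intro continuous_intros, simp add: triangle_iff)
    show "h (x, a) = 0" if "a < x" "x < b" for x
      using row[of x a] that by simp
  qed (use ab in simp)
  show h0: "h p = 0" if "p \<in> triangle a b" for p
  proof -
    obtain x y where p: "p = (x, y)" by fastforce
    with that have "a \<le> y" "y \<le> x" "x \<le> b" by (simp_all add: triangle_iff)
    then show ?thesis using corner row[of x y] p by (cases "x = a") simp_all
  qed
  fix i x assume i: "i \<le> n" and x: "x \<in> {a..b}"
  show "R i x = 0"
  proof (rule continuous_zero_on_Icc[OF R[OF i] _ ab x])
    fix x assume x: "a < x" "x < b"
    show "R i x = 0"
    proof (rule jet_coefficients_zero[OF ab x(1) less_imp_le[OF x(2)] _ i, of "\<lambda>i. R i x"])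
      fix \<phi> assume \<phi>: "\<phi> \<in> flat_functions a b"
      have "integral {a..x} (\<lambda>z. h (x, z) * \<phi> z) = integral {a..x} (\<lambda>z. 0)"
        by (rule integral_cong) (use x h0 in \<open>auto simp: triangle_iff\<close>)
      then show "(\<Sum>i\<le>n. R i x * (deriv_interval a b ^^ i) \<phi> x) = 0"
        using zero[OF \<phi>, of x] x by simp
    qed
  qed
qed

lemma normal_form_unique:
  assumes ab: "a < b"
    and P: "\<forall>i\<le>n. P i \<in> smooth_interval a b" and f: "f \<in> smooth_triangle a b"
    and Q: "\<forall>i\<le>m. Q i \<in> smooth_interval a b" and g: "g \<in> smooth_triangle a b"
    and eq: "normal_form a b n P f = normal_form a b m Q g"
  shows "f = g"
    and "\<And>i x. x \<in> {a..b} \<Longrightarrow> (if i \<le> n then P i x else 0) = (if i \<le> m then Q i x else 0)"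
proof -
  let ?N = "max n m"
  define R where "R i x = (if i \<le> n then P i x else 0) - (if i \<le> m then Q i x else 0)" for i x
  define h where "h p = f p - g p" for p
  have fg: "continuous_on (triangle a b) f" "continuous_on (triangle a b) g"
    using f g by (auto simp: smooth_triangle_def intro: smooth_on_triangle_continuous)
  have hc: "continuous_on (triangle a b) h"
    unfolding h_def by (intro continuous_intros fg)
  have Rc: "continuous_on {a..b} (R i)" for i
    unfolding R_def using P Q
    by (intro continuous_on_diff; cases "i \<le> n"; cases "i \<le> m") (auto intro: smooth_interval_continuous)
  have zero: "(\<Sum>i\<le>?N. R i x * (deriv_interval a b ^^ i) \<phi> x) + integral {a..x} (\<lambda>z. h (x, z) * \<phi> z) = 0"
    if \<phi>: "\<phi> \<in> flat_functions a b" and x: "x \<in> {a..b}" for \<phi> x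
  proof -
    let ?d = "\<lambda>i. (deriv_interval a b ^^ i) \<phi> x"
    have diff_P: "(\<Sum>i\<le>?N. R i x * ?d i) = (\<Sum>i\<le>n. P i x * ?d i) - (\<Sum>i\<le>m. Q i x * ?d i)"
      unfolding sum_atMost_pad[of n ?N "\<lambda>i. P i x" ?d, OF max.cobounded1]
        sum_atMost_pad[of m ?N "\<lambda>i. Q i x" ?d, OF max.cobounded2] sum_subtractf[symmetric]
      by (intro sum.cong) (simp_all add: R_def left_diff_distrib)
    have diff_f: "integral {a..x} (\<lambda>z. h (x, z) * \<phi> z) =
        integral {a..x} (\<lambda>z. f (x, z) * \<phi> z) - integral {a..x} (\<lambda>z. g (x, z) * \<phi> z)"
      unfolding h_def left_diff_distrib
      by (intro integral_diff integrable_continuous_real volterra_continuous[OF _ _ x] fg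
          flat_functions_continuous \<phi>)
    have "normal_form a b n P f \<phi> x - normal_form a b m Q g \<phi> x = 0" by (simp add: eq)
    then show ?thesis
      unfolding diff_P diff_f normal_form_apply[OF \<phi> x] add_diff_add .
  qed
  have h0: "h p = 0" if "p \<in> triangle a b" for p
    by (rule normal_form_coefficients_zero(1)[where R = R and n = ?N and h = h and a = a and b = b])
      (assumption | rule ab Rc hc zero that)+
  have R0: "R i x = 0" if "i \<le> ?N" "x \<in> {a..b}" for i x
    by (rule normal_form_coefficients_zero(2)[where R = R and n = ?N and h = h and a = a and b = b])
      (assumption | rule ab Rc hc zero that)+
  show "f = g"
  proof (rule extensionalityI[of _ "triangle a b"])
    fix p assume "p \<in> triangle a b"
    from h0[OF this] show "f p = g p" by (simp add: h_def)
  qed (use f g in \<open>auto simp: smooth_triangle_def\<close>)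
  fix i x assume x: "x \<in> {a..b}"
  show "(if i \<le> n then P i x else 0) = (if i \<le> m then Q i x else 0)"
  proof (cases "i \<le> ?N")
    case True
    from R0[OF this x] show ?thesis by (simp add: R_def)
  qed auto
qed

theorem corollary3:
  fixes a b :: real and T :: operator
  assumes "a < b" and "T \<in> I_M a b"
  shows "(\<exists>n P f. (\<forall>i\<le>n. P i \<in> smooth_interval a b) \<and> f \<in> smooth_triangle a b
            \<and> T = normal_form a b n P f)
       \<and> (\<forall>n P f m Q g.
            (\<forall>i\<le>n. P i \<in> smooth_interval a b) \<and> f \<in> smooth_triangle a b
              \<and> T = normal_form a b n P f
            \<and> (\<forall>i\<le>m. Q i \<in> smooth_interval a b) \<and> g \<in> smooth_triangle a b
              \<and> T = normal_form a b m Q g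
            \<longrightarrow> f = g
              \<and> (\<forall>i. i \<le> n \<and> i \<le> m \<longrightarrow> P i = Q i)
              \<and> (\<forall>i. m < i \<and> i \<le> n \<longrightarrow> P i = (\<lambda>x\<in>{a..b}. 0))
              \<and> (\<forall>i. n < i \<and> i \<le> m \<longrightarrow> Q i = (\<lambda>x\<in>{a..b}. 0)))"
proof (intro conjI allI impI; (elim conjE)?)
  show "\<exists>n P f. (\<forall>i\<le>n. P i \<in> smooth_interval a b) \<and> f \<in> smooth_triangle a b \<and> T = normal_form a b n P f"
    using normal_ops_normal_form[OF assms(1) I_M_subset_normal_ops[OF assms]] .
next
  fix n P f m Q g
  assume P: "\<forall>i\<le>n. P i \<in> smooth_interval a b" and f: "f \<in> smooth_triangle a b"
    and T: "T = normal_form a b n P f"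
    and Q: "\<forall>i\<le>m. Q i \<in> smooth_interval a b" and g: "g \<in> smooth_triangle a b"
    and T': "T = normal_form a b m Q g"
  note unique = normal_form_unique[OF assms(1) P f Q g trans[OF T[symmetric] T']]
  have P_ext: "P i \<in> extensional {a..b}" if "i \<le> n" for i
    by (rule smooth_interval_extensional) (use P that in blast)
  have Q_ext: "Q i \<in> extensional {a..b}" if "i \<le> m" for i
    by (rule smooth_interval_extensional) (use Q that in blast)
  show "f = g" by (rule unique(1))
  show "P i = Q i" if "i \<le> n" "i \<le> m" for i
    using unique(2)[of _ i] that by (intro extensionalityI[OF P_ext Q_ext]) simp_all
  show "P i = (\<lambda>x\<in>{a..b}. 0)" if "m < i" "i \<le> n" for i
    using unique(2)[of _ i] that by (intro extensionalityI[OF P_ext]) simp_all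
  show "Q i = (\<lambda>x\<in>{a..b}. 0)" if "n < i" "i \<le> m" for i
    using unique(2)[of _ i] that by (intro extensionalityI[OF Q_ext]) simp_all
qed

end
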